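(* Let $p$ be a polynomial of degree $d\ge 2$ with connected Julia set $J(p)$ and let $f$ be a Poincaré function of $p$. If $\operatorname{area} K(p)>0$, then $\operatorname{area} I(f)=0$.
   Context: $g^n$ denotes the $n$-th iterate of an entire function $g$. For a polynomial $p$ of degree at least $2$, the Julia set $J(p)$ is the complement in $\mathbb{C}$ of the set of points at which the iterates $p^n$ form a normal family, and the filled Julia set is $K(p)=\{z\in\mathbb{C}: p^n(z)\not\to\infty\}$. For an entire function $f$, the escaping set $I(f)$ is the set of all $z\in\mathbb{C}$ with $f^n(z)\to\infty$ as $n\to\infty$. Poincaré functions: let $p$ be a polynomial of degree $d\ge2$ and let $z_0\in\mathbb{C}$ be a repelling fixed point of $p$, that is, $p(z_0)=z_0$ and $\lambda:=p'(z_0)$ satisfies $|\lambda|>1$. Schröder's functional equation $f(\lambda z)=p(f(z))$ has a solution $f$ holomorphic in a neighborhood of $0$ with $f(0)=z_0$ and normalized by $f'(0)=1$; it extends to a transcendental entire function, called the Poincaré function of $p$ at $z_0$. A Poincaré function of $p$ is the Poincaré function of $p$ at some repelling fixed point. $\operatorname{area}$ denotes two-dimensional Lebesgue measure. *)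

theory Defs
  imports "HOL-Complex_Analysis.Complex_Analysis"
begin

text \<open>
  Normality in the sense of Montel for families of holomorphic functions on an open set: every
  sequence in the family has a subsequence that converges uniformly on compact subsets either to
  a holomorphic function or to infinity. On connected sets this is normality with respect to the
  spherical metric; on disconnected sets it is stricter, which does not matter for normality at
  a point, since a neighbourhood may be shrunk to a disk.
\<close>

definition normal_family_on :: "complex set \<Rightarrow> (complex \<Rightarrow> complex) set \<Rightarrow> bool" where
  "normal_family_on U F \<longleftrightarrow>
     (\<forall>s :: nat \<Rightarrow> complex \<Rightarrow> complex. range s \<subseteq> F \<longrightarrow>
        (\<exists>r :: nat \<Rightarrow> nat. strict_mono r \<and>
           ((\<exists>g. g holomorphic_on U \<and>
               (\<forall>C. compact C \<and> C \<subseteq> U \<longrightarrow> uniform_limit C (\<lambda>n. s (r n)) g sequentially)) \<or>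
            (\<forall>C. compact C \<and> C \<subseteq> U \<longrightarrow>
               (\<forall>B. \<forall>\<^sub>F n in sequentially. \<forall>z\<in>C. B \<le> norm (s (r n) z))))))"

definition normal_at :: "(complex \<Rightarrow> complex) set \<Rightarrow> complex \<Rightarrow> bool" where
  "normal_at F z \<longleftrightarrow> (\<exists>U. open U \<and> z \<in> U \<and> normal_family_on U F)"

definition Julia_set :: "complex poly \<Rightarrow> complex set" where
  "Julia_set p = - {z. normal_at {poly p ^^ n |n. True} z}"

definition escaping_set :: "(complex \<Rightarrow> complex) \<Rightarrow> complex set" where
  "escaping_set f = {z. filterlim (\<lambda>n. (f ^^ n) z) at_infinity sequentially}"

definition filled_Julia_set :: "complex poly \<Rightarrow> complex set" where
  "filled_Julia_set p = {z. \<not> filterlim (\<lambda>n. (poly p ^^ n) z) at_infinity sequentially}"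

definition repelling_fixed_point :: "complex poly \<Rightarrow> complex \<Rightarrow> bool" where
  "repelling_fixed_point p z0 \<longleftrightarrow> poly p z0 = z0 \<and> norm (poly (pderiv p) z0) > 1"

text \<open>
  The entire extension of the normalized local solution of Schroeder's functional equation;
  the equation is imposed only near 0, where the local solution lives.
\<close>

definition Poincare_function_at :: "complex poly \<Rightarrow> complex \<Rightarrow> (complex \<Rightarrow> complex) \<Rightarrow> bool" where
  "Poincare_function_at p z0 f \<longleftrightarrow>
     f holomorphic_on UNIV \<and> f 0 = z0 \<and> deriv f 0 = 1 \<and>
     (\<forall>\<^sub>F z in nhds 0. f (poly (pderiv p) z0 * z) = poly p (f z))"

definition Poincare_function :: "complex poly \<Rightarrow> (complex \<Rightarrow> complex) \<Rightarrow> bool" where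
  "Poincare_function p f \<longleftrightarrow>
     (\<exists>z0. repelling_fixed_point p z0 \<and> Poincare_function_at p z0 f)"

end

theory Submission
  imports Defs "HOL-Computational_Algebra.Fundamental_Theorem_Algebra"
begin

text \<open>
  Write \<open>K\<close> for the filled Julia set, \<open>\<mu>\<close> for the multiplier of the repelling fixed point \<open>z0\<close>, and recall
  \<open>f (\<mu> * z) = p (f z)\<close>. The idea is that \<open>f\<close> expands strongly where it is large, while the points that
  \<open>f\<close> maps into the bounded set \<open>K\<close> fill, on a logarithmic scale, a fixed proportion of the plane; pulling this
  proportion back along an orbit that stays large shows that such orbits start in a null set.

  The connectedness of the Julia set enters through the geometry of the basin of infinity. It makes
  \<open>K\<close> connected (\<open>connected_K\<close>), so the complement of \<open>K\<close> in the sphere is simply connected, and a Riemann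
  map conjugates \<open>p\<close> there to a power map of the unit disc (\<open>basin_conjugate_to_power\<close>): a proper self-map
  of the disc whose only zero is at the origin is a constant times a power. Taking logarithms gives a
  holomorphic \<open>\<Psi>\<close> from the right half-plane onto the complement of \<open>K\<close> with
  \<open>p (\<Psi> \<zeta>) = \<Psi> (degree p * \<zeta>)\<close> (\<open>Boettcher_uniformization\<close>). Because
  \<open>f z = p^n (f (z / \<mu>^n))\<close>, an inverse branch of \<open>f\<close> over a subset of the basin is obtained by undoing \<open>p^n\<close>,
  that is, dividing \<open>\<zeta>\<close> by \<open>degree p ^ n\<close>, and then undoing \<open>f\<close> near 0, where it is univalent
  (\<open>inverse_branch\<close>).

  Now pass to the coordinate \<open>x = log z\<close>. The set of all \<open>x\<close> with \<open>f (exp x) \<in> K\<close> is invariant under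
  translation by \<open>2 \<pi> i\<close> and by \<open>log \<mu>\<close>. Hence it meets every disc of a certain radius, and if \<open>K\<close> has
  positive area then it has at least a fixed positive area in every slightly larger disc. An inverse
  branch \<open>G\<close> of \<open>f\<close> in this coordinate, defined on a disc, avoids it, so the image of \<open>G\<close> contains no
  large disc and Bloch's theorem bounds the derivative of \<open>G\<close> at the centre by a constant over the radius. Far to the right \<open>G\<close> is therefore a contraction by \<open>1/2\<close>.
  It is also univalent on unit discs, hence has bounded distortion, and since the images shrink
  geometrically, compositions of any number of such branches have bounded distortion with one common
  constant (\<open>branch_chain\<close>).

  Finally, let the orbit of \<open>exp x\<close> under \<open>f\<close> stay far out. The \<open>n\<close>-fold inverse branch at the \<open>n\<close>-th point of
  the orbit maps a disc of fixed size, in which a fixed area is sent into \<open>K\<close> by the next step, onto a tiny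
  neighbourhood of \<open>x\<close> of comparable shape. The image of that area consists of points whose orbits do
  not stay far out. So the set of points with far orbits has density bounded away from 1 in
  arbitrarily small discs around each of its points, and by Vitali's covering theorem it is null
  (\<open>negligible_far_orbits\<close>). The escaping set lies in the countable union of the preimages, under the
  iterates of \<open>f\<close>, of the image of this set under \<open>exp\<close>.
\<close>

section \<open>Negligible sets and areas of holomorphic images\<close>

lemma lmeasurable_outer_open:
  assumes S: "S \<in> lmeasurable" and "e > 0"
  obtains T where "open T" "S \<subseteq> T" "T \<in> lmeasurable" "emeasure lebesgue (T - S) < ennreal e"
proof -
  obtain T where T: "open T" "S \<subseteq> T" "(T - S) \<in> lmeasurable" "emeasure lebesgue (T - S) < ennreal e"
    using sets_lebesgue_outer_open[of S e] assms by blast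
  then have "S \<union> (T - S) \<in> lmeasurable"
    using S by (intro fmeasurable.Un) auto
  also have "S \<union> (T - S) = T" using T by blast
  finally show ?thesis using that T by blast
qed

text \<open>
  A weak form of the Lebesgue density theorem. Cover \<open>S\<close>, up to a null set, by disjoint balls inside an open
  superset of nearly the same measure; in each ball \<open>S\<close> has proportion at most \<open>1 - \<kappa>\<close>, so the
  measure of \<open>S\<close> is at most \<open>1 - \<kappa>\<close> times itself.
\<close>

lemma negligible_if_not_dense:
  fixes S :: "'a::euclidean_space set"
  assumes S: "S \<in> sets lebesgue" and \<kappa>: "0 < \<kappa>" "\<kappa> \<le> 1"
    and dens: "\<And>x d. x \<in> S \<Longrightarrow> 0 < d \<Longrightarrow>
      \<exists>s. 0 < s \<and> s < d \<and> measure lebesgue (S \<inter> ball x s) \<le> (1 - \<kappa>) * measure lebesgue (ball x s)"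
  shows "negligible S"
proof -
  have *: "negligible (S \<inter> T)" if T: "T \<in> lmeasurable" for T
  proof -
    let ?S = "S \<inter> T"
    have SS: "?S \<in> lmeasurable"
      using fmeasurable_Int_fmeasurable[OF T S] by (simp add: inf_commute)
    have bound: "emeasure lebesgue ?S \<le> ennreal (1 - \<kappa>) * (emeasure lebesgue ?S + ennreal e)" if e: "0 < e" for e :: real
    proof -
      obtain U where U: "open U" "?S \<subseteq> U" "U \<in> lmeasurable" "emeasure lebesgue (U - ?S) < ennreal e"
        using lmeasurable_outer_open[OF SS e] by metis
      define K where "K = {(x, s). x \<in> ?S \<and> 0 < s \<and> ball x s \<subseteq> U \<and>
          measure lebesgue (?S \<inter> ball x s) \<le> (1 - \<kappa>) * measure lebesgue (ball x s)}"
      obtain C where C: "countable C" "C \<subseteq> K"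
        "pairwise (\<lambda>i j. disjnt (ball (fst i) (snd i)) (ball (fst j) (snd j))) C"
        "negligible (?S - (\<Union>i\<in>C. ball (fst i) (snd i)))"
      proof (rule Vitali_covering_theorem_balls[of ?S K fst snd])
        fix x and d :: real
        assume x: "x \<in> ?S" and d: "0 < d"
        obtain h where h: "0 < h" "ball x h \<subseteq> U"
          using U x open_contains_ball by blast
        obtain s where s: "0 < s" "s < min d h"
          "measure lebesgue (S \<inter> ball x s) \<le> (1 - \<kappa>) * measure lebesgue (ball x s)"
          using dens[of x "min d h"] x d h by auto
        have "measure lebesgue (?S \<inter> ball x s) \<le> measure lebesgue (S \<inter> ball x s)"
          using SS fmeasurable_Int_fmeasurable[of "ball x s" lebesgue S] S
          by (intro measure_mono_fmeasurable) (auto simp: inf_commute)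
        then have "(x, s) \<in> K"
          using s h x by (auto simp: K_def)
        then show "\<exists>i. i \<in> K \<and> x \<in> ball (fst i) (snd i) \<and> snd i < d"
          using s by force
      qed blast
      let ?B = "\<lambda>i. ball (fst i :: 'a) (snd i)"
      have disj1: "disjoint_family_on ?B C"
        using C(3) by (auto simp: disjoint_family_on_def pairwise_def disjnt_def)
      then have "disjoint_family_on (\<lambda>i. ?S \<inter> ?B i) C"
        unfolding disjoint_family_on_def by blast
      note disj = disj1 this
      have "emeasure lebesgue ?S \<le> emeasure lebesgue ((\<Union>i\<in>C. ?S \<inter> ?B i) \<union> (?S - (\<Union>i\<in>C. ?B i)))"
        using S T C(1,4) by (intro emeasure_mono)
          (auto simp: negligible_iff_null_sets intro!: sets.Un sets.countable_UN' sets.Int sets.Diff)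
      also have "\<dots> = emeasure lebesgue (\<Union>i\<in>C. ?S \<inter> ?B i)"
        using S T C(1,4)
        by (intro emeasure_Un_null_set sets.countable_UN')
          (auto simp: negligible_iff_null_sets intro!: sets.Int)
      also have "\<dots> = (\<integral>\<^sup>+i. emeasure lebesgue (?S \<inter> ?B i) \<partial>count_space C)"
        using S T C(1) disj by (intro emeasure_UN_countable) auto
      also have "\<dots> \<le> (\<integral>\<^sup>+i. ennreal (1 - \<kappa>) * emeasure lebesgue (?B i) \<partial>count_space C)"
      proof (rule nn_integral_mono)
        fix i assume "i \<in> space (count_space C)"
        then have "i \<in> K" using C by auto
        then have "measure lebesgue (?S \<inter> ?B i) \<le> (1 - \<kappa>) * measure lebesgue (?B i)"
          by (auto simp: K_def)
        moreover have "?S \<inter> ?B i \<in> lmeasurable"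
          using SS by (simp add: fmeasurable_Int_fmeasurable)
        ultimately show "emeasure lebesgue (?S \<inter> ?B i) \<le> ennreal (1 - \<kappa>) * emeasure lebesgue (?B i)"
          using \<kappa> by (simp add: emeasure_eq_measure2 flip: ennreal_mult')
      qed
      also have "\<dots> = ennreal (1 - \<kappa>) * (\<integral>\<^sup>+i. emeasure lebesgue (?B i) \<partial>count_space C)"
        by (intro nn_integral_cmult) auto
      also have "(\<integral>\<^sup>+i. emeasure lebesgue (?B i) \<partial>count_space C) = emeasure lebesgue (\<Union>i\<in>C. ?B i)"
        using C(1) disj by (intro emeasure_UN_countable[symmetric]) auto
      also have "\<dots> \<le> emeasure lebesgue (?S \<union> (U - ?S))"
      proof (rule emeasure_mono)
        show "(\<Union>i\<in>C. ?B i) \<subseteq> ?S \<union> (U - ?S)"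
          using C(2) by (fastforce simp: K_def)
      qed (use U S T in auto)
      also have "\<dots> \<le> emeasure lebesgue ?S + emeasure lebesgue (U - ?S)"
        using U S T by (intro emeasure_subadditive) auto
      also have "\<dots> \<le> emeasure lebesgue ?S + ennreal e"
        using U(4) by (simp add: add_left_mono less_imp_le)
      finally show ?thesis
        by (simp add: mult_left_mono)
    qed
    define m where "m = measure lebesgue ?S"
    have m0: "0 \<le> m" by (simp add: m_def)
    have em: "emeasure lebesgue ?S = ennreal m"
      using SS by (simp add: emeasure_eq_measure2 m_def)
    have le: "m \<le> (1 - \<kappa>) * (m + e)" if "0 < e" for e
      using bound[OF that] that \<kappa> m0 unfolding em
      by (simp add: ennreal_mult'[symmetric] ennreal_plus[symmetric] del: ennreal_plus)
    have "\<kappa> * m \<le> (1-\<kappa>) * e" if "0 < e" for e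
      using le[OF that] by (simp add: algebra_simps)
    moreover have "(1-\<kappa>) * e \<le> 0 + e" if "0 < e" for e
      using that \<kappa> mult_right_mono[of "1-\<kappa>" 1 e] by simp
    ultimately have "\<kappa> * m \<le> 0 + e" if "0 < e" for e
      using that by (meson order_trans)
    then have "\<kappa> * m \<le> 0"
      using field_le_epsilon by blast
    then have "m = 0" using \<kappa> m0
      by (simp add: mult_le_0_iff)
    then show ?thesis
      using em SS by (simp add: negligible_iff_null_sets null_setsI fmeasurableD)
  qed
  have "S = (\<Union>n::nat. S \<inter> ball 0 (real n))"
    by (auto simp: reals_Archimedean2)
  moreover have "negligible (\<Union>n::nat. S \<inter> ball 0 (real n))"
    using * by (intro negligible_countable_Union) auto
  ultimately show ?thesis by simp
qed

lemma emeasure_UN_countable_le: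
  assumes sets[measurable]: "\<And>i. i \<in> I \<Longrightarrow> X i \<in> sets M" and I[simp]: "countable I"
  shows "emeasure M (\<Union>(X ` I)) \<le> (\<integral>\<^sup>+i. emeasure M (X i) \<partial>count_space I)"
proof -
  have le: "indicator (\<Union>(X ` I)) x \<le> (\<integral>\<^sup>+ i. indicator (X i) x \<partial>count_space I)" for x
  proof (cases "x \<in> \<Union>(X ` I)")
    case True
    then obtain j where j: "x \<in> X j" "j \<in> I" by auto
    have "(\<integral>\<^sup>+ i. indicator {j} i \<partial>count_space I) \<le> (\<integral>\<^sup>+ i. indicator (X i) x \<partial>count_space I)"
      using j by (intro nn_integral_mono) (auto split: split_indicator)
    then show ?thesis using j True by simp
  qed auto
  note sets.countable_UN'[unfolded subset_eq, measurable]
  have "emeasure M (\<Union>(X ` I)) = (\<integral>\<^sup>+x. indicator (\<Union>(X ` I)) x \<partial>M)"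
    by simp
  also have "\<dots> \<le> (\<integral>\<^sup>+x. \<integral>\<^sup>+i. indicator (X i) x \<partial>count_space I \<partial>M)"
    by (intro nn_integral_mono le)
  also have "\<dots> = (\<integral>\<^sup>+i. \<integral>\<^sup>+x. indicator (X i) x \<partial>M \<partial>count_space I)"
    by (simp add: nn_integral_count_space_nn_integral)
  finally show ?thesis
    by (simp cong: nn_integral_cong_simp)
qed

text \<open>
  A ball of radius \<open>r\<close> is mapped into a ball of radius \<open>q * r\<close>, whose area is \<open>q\<^sup>2\<close> times as large. Vitali's
  theorem fills an open superset of \<open>S\<close> with disjoint balls up to a null set, and null sets have null images.
\<close>

lemma measure_holomorphic_image_le:
  assumes V: "open V" and f: "f holomorphic_on V" and q: "0 < q"
    and df: "\<And>z. z \<in> V \<Longrightarrow> norm (deriv f z) \<le> q"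
    and S: "S \<subseteq> V" "S \<in> lmeasurable"
  shows "f ` S \<in> lmeasurable" "measure lebesgue (f ` S) \<le> q\<^sup>2 * measure lebesgue S"
proof -
  have diff: "f differentiable_on V"
    by (simp add: V f holomorphic_on_imp_differentiable_on)
  have fS: "f ` S \<in> sets lebesgue"
    using S diff differentiable_image_in_sets_lebesgue[of S f]
    by (auto intro: differentiable_on_subset fmeasurableD)
  have bound: "emeasure lebesgue (f ` S) \<le> ennreal (q\<^sup>2) * (emeasure lebesgue S + ennreal e)" if e: "0 < e" for e :: real
  proof -
    obtain U0 where U0: "open U0" "S \<subseteq> U0" "U0 \<in> lmeasurable" "emeasure lebesgue (U0 - S) < ennreal e"
      using lmeasurable_outer_open[OF S(2) e] by metis
    define U where "U = U0 \<inter> V"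
    have U: "open U" "S \<subseteq> U" "U \<subseteq> U0" "U \<subseteq> V" using U0 V S by (auto simp: U_def)
    define K where "K = {(x, s). 0 < s \<and> ball x s \<subseteq> U}"
    obtain C where C: "countable C" "C \<subseteq> K"
      "pairwise (\<lambda>i j. disjnt (ball (fst i) (snd i)) (ball (fst j) (snd j))) C"
      "negligible (U - (\<Union>i\<in>C. ball (fst i) (snd i)))"
    proof (rule Vitali_covering_theorem_balls[of U K fst snd])
      fix x and d :: real
      assume x: "x \<in> U" and d: "0 < d"
      obtain h where h: "0 < h" "ball x h \<subseteq> U"
        using U x open_contains_ball by blast
      then have "(x, min h (d/2)) \<in> K"
        using d by (auto simp: K_def)
      then show "\<exists>i. i \<in> K \<and> x \<in> ball (fst i) (snd i) \<and> snd i < d"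
        using d h by force
    qed blast
    let ?B = "\<lambda>i. ball (fst i :: complex) (snd i)"
    let ?N = "U - (\<Union>i\<in>C. ?B i)"
    have disj: "disjoint_family_on ?B C"
      using C(3) by (auto simp: disjoint_family_on_def pairwise_def disjnt_def)
    have fN: "negligible (f ` ?N)"
      using C(4) diff U by (intro negligible_differentiable_image_negligible)
        (auto intro: differentiable_on_subset)
    have fB: "f ` ?B i \<subseteq> ball (f (fst i)) (q * snd i)" if "i \<in> C" for i
    proof -
      have "i \<in> K" using that C(2) by blast
      then have iV: "?B i \<subseteq> V" and si: "0 < snd i"
        using U(4) by (auto simp: K_def)
      have "norm (f y - f (fst i)) \<le> q * norm (y - fst i)" if "y \<in> ?B i" for y
      proof (rule field_differentiable_bound[where S = "?B i" and f' = "deriv f"])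
        fix z assume "z \<in> ?B i"
        then show "(f has_field_derivative deriv f z) (at z within ?B i)"
          using iV V f by (meson has_field_derivative_at_within holomorphic_derivI subsetD)
        show "norm (deriv f z) \<le> q" using \<open>z \<in> ?B i\<close> iV df by blast
      qed (use that si in auto)
      then show ?thesis
        using q by (force simp: dist_norm norm_minus_commute intro: le_less_trans)
    qed
    have "emeasure lebesgue (f ` S) \<le> emeasure lebesgue ((\<Union>i\<in>C. ball (f (fst i)) (q * snd i)) \<union> f ` ?N)"
    proof (rule emeasure_mono)
      show "f ` S \<subseteq> (\<Union>i\<in>C. ball (f (fst i)) (q * snd i)) \<union> f ` ?N"
        using U(2) fB by blast
      show "(\<Union>i\<in>C. ball (f (fst i)) (q * snd i)) \<union> f ` ?N \<in> sets lebesgue"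
        using C(1) fN by (auto simp: negligible_iff_null_sets intro!: sets.countable_UN')
    qed
    also have "\<dots> = emeasure lebesgue (\<Union>i\<in>C. ball (f (fst i)) (q * snd i))"
      using C(1) fN
      by (intro emeasure_Un_null_set sets.countable_UN')
        (auto simp: negligible_iff_null_sets)
    also have "\<dots> \<le> (\<integral>\<^sup>+i. emeasure lebesgue (ball (f (fst i)) (q * snd i)) \<partial>count_space C)"
      using C(1) by (intro emeasure_UN_countable_le) auto
    also have "\<dots> = (\<integral>\<^sup>+i. ennreal (q\<^sup>2) * emeasure lebesgue (?B i) \<partial>count_space C)"
    proof (rule nn_integral_cong)
      fix i assume "i \<in> space (count_space C)"
      then have "0 < snd i" using C by (auto simp: K_def)
      then have "measure lebesgue (ball (f (fst i)) (q * snd i)) = q\<^sup>2 * measure lebesgue (?B i)"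
        using q content_ball_conv_unit_ball[of "q * snd i" "f (fst i)"]
          content_ball_conv_unit_ball[of "snd i" "fst i"] by (simp add: power_mult_distrib)
      then show "emeasure lebesgue (ball (f (fst i)) (q * snd i)) = ennreal (q\<^sup>2) * emeasure lebesgue (?B i)"
        by (simp add: emeasure_eq_measure2 flip: ennreal_mult')
    qed
    also have "\<dots> = ennreal (q\<^sup>2) * (\<integral>\<^sup>+i. emeasure lebesgue (?B i) \<partial>count_space C)"
      by (intro nn_integral_cmult) auto
    also have "(\<integral>\<^sup>+i. emeasure lebesgue (?B i) \<partial>count_space C) = emeasure lebesgue (\<Union>i\<in>C. ?B i)"
      using C(1) disj by (intro emeasure_UN_countable[symmetric]) auto
    also have "\<dots> \<le> emeasure lebesgue (S \<union> (U0 - S))"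
    proof (rule emeasure_mono)
      show "(\<Union>i\<in>C. ?B i) \<subseteq> S \<union> (U0 - S)"
        using C(2) U(3) by (fastforce simp: K_def)
    qed (use U0 S in auto)
    also have "\<dots> \<le> emeasure lebesgue S + emeasure lebesgue (U0 - S)"
      using U0 S by (intro emeasure_subadditive) auto
    also have "\<dots> \<le> emeasure lebesgue S + ennreal e"
      using U0(4) by (simp add: add_left_mono less_imp_le)
    finally show ?thesis
      by (simp add: mult_left_mono)
  qed
  define m where "m = measure lebesgue S"
  have m0: "0 \<le> m" by (simp add: m_def)
  have em: "emeasure lebesgue S = ennreal m"
    using S by (simp add: emeasure_eq_measure2 m_def)
  have b2: "emeasure lebesgue (f ` S) \<le> ennreal (q\<^sup>2 * (m + e))" if "0 < e" for e
    using bound[OF that] that q m0 unfolding em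
    by (simp add: ennreal_mult'[symmetric] ennreal_plus[symmetric] del: ennreal_plus)
  show lm: "f ` S \<in> lmeasurable"
    using b2[of 1] fS by (intro fmeasurableI) (auto simp: le_less_trans)
  have "measure lebesgue (f ` S) \<le> q\<^sup>2 * m + e" if "0 < e" for e
  proof -
    have "measure lebesgue (f ` S) \<le> q\<^sup>2 * (m + e / q\<^sup>2)"
      using b2[of "e / q\<^sup>2"] that q m0 lm by (simp add: emeasure_eq_measure2)
    also have "\<dots> = q\<^sup>2 * m + e" using q by (simp add: distrib_left)
    finally show ?thesis .
  qed
  then show "measure lebesgue (f ` S) \<le> q\<^sup>2 * measure lebesgue S"
    unfolding m_def[symmetric] using field_le_epsilon by blast
qed

section \<open>Distortion of locally univalent functions\<close>

text \<open>
  The bound on the second coefficient of univalent functions, with a constant that is far from optimal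
  but comes cheaply. After normalization \<open>\<phi>\<close> omits some \<open>a\<close> of modulus less than 2, by Schwarz's lemma
  for the inverse. A square root of \<open>1 - \<phi> / a\<close> omits 0 and, as \<open>\<phi>\<close> is univalent, also the negative of
  its value at 0. So Schottky's theorem bounds it, and with it \<open>\<phi>\<close>, near 0.
\<close>

lemma univalent_second_derivative_bound:
  obtains C where "0 < C"
    "\<And>\<phi>. \<phi> holomorphic_on ball 0 1 \<Longrightarrow> inj_on \<phi> (ball 0 1) \<Longrightarrow> norm (deriv (deriv \<phi>) 0) \<le> C * norm (deriv \<phi> 0)"
proof -
  define B where "B = exp(pi * exp(pi * (2 + 2 * 1 + 12 * (1/2) / (1 - 1/2))))"
  define C where "C = 64 * (1 + B\<^sup>2)"
  have B: "0 < B" by (simp add: B_def)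
  have "0 \<le> B\<^sup>2" by simp
  then have C: "0 < C" unfolding C_def by (intro mult_pos_pos add_pos_nonneg) auto
  have main: "norm (deriv (deriv \<phi>) 0) \<le> C"
    if hol: "\<phi> holomorphic_on ball 0 1" and inj: "inj_on \<phi> (ball 0 1)" and z: "\<phi> 0 = 0" and d1: "deriv \<phi> 0 = 1" for \<phi>
  proof -
    \<comment> \<open>If the image contained the disc of radius 2, then the inverse, rescaled, would map the unit disc
      into itself with derivative 2 at 0.\<close>
    have "\<exists>a. norm a < 2 \<and> a \<notin> \<phi> ` ball 0 1"
    proof (rule ccontr)
      assume "\<not> ?thesis"
      then have sub: "ball 0 2 \<subseteq> \<phi> ` ball 0 1"
        by (auto simp: subset_iff)
      obtain g where g: "g holomorphic_on \<phi> ` ball 0 1"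
        "\<And>z. z \<in> ball 0 1 \<Longrightarrow> deriv \<phi> z * deriv g (\<phi> z) = 1"
        "\<And>z. z \<in> ball 0 1 \<Longrightarrow> g (\<phi> z) = z"
        using holomorphic_has_inverse[OF hol open_ball inj] by metis
      have dg: "deriv g 0 = 1"
        using g(2)[of 0] z d1 by simp
      have im: "norm (g w) < 1" if "w \<in> ball 0 2" for w
        using g(3) that sub by fastforce
      have g0: "g 0 = 0" using g(3)[of 0] z by simp
      have gh: "g holomorphic_on ball 0 2"
        using g(1) sub holomorphic_on_subset by blast
      let ?h = "\<lambda>w. g (2 * w)"
      have hh: "?h holomorphic_on ball 0 1"
        by (rule holomorphic_on_compose_gen[OF _ gh, unfolded o_def])
          (auto intro!: holomorphic_intros simp: norm_mult)
      have "deriv ?h 0 = 2 * deriv g 0"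
      proof -
        have "(g has_field_derivative deriv g 0) (at (2 * 0))"
          using gh by (simp add: holomorphic_derivI)
        then have "(?h has_field_derivative deriv g 0 * 2) (at 0)"
          by (rule DERIV_chain2) (auto intro!: derivative_eq_intros)
        then show ?thesis by (simp add: DERIV_imp_deriv mult.commute)
      qed
      moreover have "norm (deriv ?h 0) \<le> 1"
        by (rule Schwarz_Lemma(2)[OF hh, of 0]) (auto simp: g0 im norm_mult)
      ultimately show False using dg by simp
    qed
    then obtain a where a: "norm a < 2" "a \<notin> \<phi> ` ball 0 1" by blast
    have a0: "a \<noteq> 0" using a(2) z by force
    have hol1: "(\<lambda>w. 1 - \<phi> w / a) holomorphic_on ball 0 1"
      by (intro holomorphic_intros hol) (use a0 in auto)
    have nz1: "1 - \<phi> w / a \<noteq> 0" if "w \<in> ball 0 1" for w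
      using a(2) a0 that by (auto simp: field_simps)
    obtain s where s: "s holomorphic_on ball 0 1" "\<And>w. w \<in> ball 0 1 \<Longrightarrow> 1 - \<phi> w / a = (s w)\<^sup>2"
      using contractible_imp_holomorphic_sqrt[OF hol1 convex_imp_contractible[OF convex_ball] nz1] by blast
    define e where "e = s 0"
    have e2: "e\<^sup>2 = 1" using s(2)[of 0] z by (simp add: e_def)
    then have "(norm e)\<^sup>2 = 1" by (simp flip: norm_power)
    then have e1: "norm e = 1"
      using norm_ge_zero[of e] by (auto simp: power2_eq_1_iff)
    \<comment> \<open>Since \<open>1 - \<phi> / a\<close> takes the value 1 only at 0, its square root \<open>s\<close> takes at 0 the value \<open>e\<close>
      and takes the value \<open>- e\<close> nowhere. Hence \<open>- e * s\<close> omits 0 and 1.\<close>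
    have ne1: "- e * s w \<noteq> 1" if w: "w \<in> ball 0 1" for w
    proof
      assume "- e * s w = 1"
      then have "e * (- e * s w) = e" by simp
      then have "- (e\<^sup>2 * s w) = e" by (simp add: power2_eq_square mult.assoc)
      then have "- s w = e" using e2 by simp
      then have "s w = - e" by auto
      then have "1 - \<phi> w / a = 1" using s(2)[OF w] e2 by simp
      then have "\<phi> w = \<phi> 0" using a0 z by simp
      then have "w = 0" using inj w by (auto dest: inj_onD)
      then show False using \<open>s w = - e\<close> e_def e1 by (auto simp: eq_neg_iff_add_eq_0)
    qed
    have ne0: "- e * s w \<noteq> 0" if w: "w \<in> ball 0 1" for w
      using s(2)[OF w] nz1[OF w] e1 by auto
    have sB: "norm (s w) \<le> B" if w: "norm w \<le> 1/4" for w
    proof -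
      let ?h = "\<lambda>v. - e * s (v / 2)"
      have "norm (?h (2 * w)) \<le> B"
        unfolding B_def
      proof (rule Schottky[of ?h 1 "1/2" "2 * w"])
        have "(\<lambda>v. s (v / 2)) holomorphic_on cball 0 1"
          by (rule holomorphic_on_compose_gen[OF _ s(1), unfolded o_def])
            (auto intro!: holomorphic_intros)
        then show "?h holomorphic_on cball 0 1"
          by (intro holomorphic_intros)
        show "norm (?h 0) \<le> 1" using e1 by (simp add: norm_mult flip: e_def)
        show "\<not> (?h v = 0 \<or> ?h v = 1)" if "v \<in> cball 0 1" for v
          using ne0[of "v / 2"] ne1[of "v / 2"] that by auto
      qed (use w in \<open>auto simp: norm_mult\<close>)
      then show ?thesis using e1 by (simp add: norm_mult)
    qed
    have pB: "norm (\<phi> w) \<le> 2 * (1 + B\<^sup>2)" if w: "norm w \<le> 1/4" for w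
    proof -
      have "\<phi> w = a * (1 - (s w)\<^sup>2)"
        using s(2)[of w] w a0 by (auto simp: field_simps)
      also have "norm \<dots> \<le> 2 * (1 + B\<^sup>2)"
        unfolding norm_mult
      proof (rule mult_mono)
        have "norm (1 - (s w)\<^sup>2) \<le> 1 + norm (s w) ^ 2"
          using norm_triangle_ineq4[of 1 "(s w)\<^sup>2"] by (simp add: norm_power)
        also have "\<dots> \<le> 1 + B\<^sup>2" using sB[OF w] by (simp add: power_mono)
        finally show "norm (1 - (s w)\<^sup>2) \<le> 1 + B\<^sup>2" .
      qed (use a in auto)
      finally show ?thesis .
    qed
    have "norm ((deriv ^^ 2) \<phi> 0) \<le> fact 2 * (2 * (1 + B\<^sup>2)) / (1/4) ^ 2"
    proof (rule Cauchy_inequality)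
      show "\<phi> holomorphic_on ball 0 (1/4)"
        by (rule holomorphic_on_subset[OF hol]) auto
      show "continuous_on (cball 0 (1/4)) \<phi>"
        by (rule holomorphic_on_imp_continuous_on, rule holomorphic_on_subset[OF hol]) auto
    qed (use pB in auto)
    then have "norm (deriv (deriv \<phi>) 0) \<le> 64 * (1 + B\<^sup>2)"
      by (simp add: numeral_2_eq_2)
    then show ?thesis by (simp add: C_def)
  qed
  have "norm (deriv (deriv \<phi>) 0) \<le> C * norm (deriv \<phi> 0)"
    if hol: "\<phi> holomorphic_on ball 0 1" and inj: "inj_on \<phi> (ball 0 1)" for \<phi>
  proof -
    define c where "c = deriv \<phi> 0"
    have c: "c \<noteq> 0"
      unfolding c_def using holomorphic_injective_imp_regular[OF hol open_ball inj] by simp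
    let ?\<psi> = "\<lambda>w. (\<phi> w - \<phi> 0) / c"
    have h: "?\<psi> holomorphic_on ball 0 1"
      by (intro holomorphic_intros hol) (use c in auto)
    have i: "inj_on ?\<psi> (ball 0 1)"
      using inj c by (auto simp: inj_on_def)
    have d: "deriv ?\<psi> w = deriv \<phi> w / c" if "w \<in> ball 0 1" for w
    proof -
      have "(\<phi> has_field_derivative deriv \<phi> w) (at w)"
        using hol that by (simp add: holomorphic_derivI)
      then have "(?\<psi> has_field_derivative deriv \<phi> w / c) (at w)"
        using c by (auto intro!: derivative_eq_intros)
      then show ?thesis by (rule DERIV_imp_deriv)
    qed
    have "deriv (deriv ?\<psi>) 0 = deriv (\<lambda>w. deriv \<phi> w / c) 0"
    proof (rule deriv_cong_ev)
      show "\<forall>\<^sub>F w in nhds 0. deriv ?\<psi> w = deriv \<phi> w / c"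
        using eventually_nhds_in_open[of "ball 0 1" "0::complex"] d
        by (auto elim!: eventually_mono)
    qed auto
    also have "\<dots> = deriv (deriv \<phi>) 0 / c"
    proof -
      have "deriv \<phi> holomorphic_on ball 0 1"
        by (simp add: hol holomorphic_deriv)
      then have "(deriv \<phi> has_field_derivative deriv (deriv \<phi>) 0) (at 0)"
        by (simp add: holomorphic_derivI)
      then have "((\<lambda>w. deriv \<phi> w / c) has_field_derivative deriv (deriv \<phi>) 0 / c) (at 0)"
        using c by (auto intro!: derivative_eq_intros)
      then show ?thesis by (rule DERIV_imp_deriv)
    qed
    finally have "norm (deriv (deriv \<phi>) 0 / c) \<le> C"
      using main[OF h i] d[of 0] c by (simp add: c_def)
    then show ?thesis
      using c by (simp add: norm_divide pos_divide_le_eq flip: c_def)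
  qed
  then show ?thesis using that C by blast
qed

text \<open>
  The bound depends on the distance of the two points and not only on the set: this is what makes the
  distortion of a long composition of contractions summable.
\<close>

definition bounded_distortion :: "real \<Rightarrow> (complex \<Rightarrow> complex) \<Rightarrow> complex set \<Rightarrow> bool" where
  "bounded_distortion C G S \<longleftrightarrow>
     (\<forall>x\<in>S. \<forall>y\<in>S. norm (deriv G x) \<le> exp (C * dist x y) * norm (deriv G y))"

lemma bounded_distortionD:
  "bounded_distortion C G S \<Longrightarrow> x \<in> S \<Longrightarrow> y \<in> S \<Longrightarrow>
     norm (deriv G x) \<le> exp (C * dist x y) * norm (deriv G y)"
  by (simp add: bounded_distortion_def)

text \<open>
  The second derivative bound, applied in the unit ball about each point, says that the logarithm of the derivative
  has derivative at most \<open>C\<close> in modulus. On the convex set \<open>S\<close> this integrates to a Lipschitz bound.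
\<close>

lemma univalent_on_unit_balls_bounded_distortion:
  obtains C where "0 < C"
    "\<And>G D S. open D \<Longrightarrow> G holomorphic_on D \<Longrightarrow> open S \<Longrightarrow> convex S \<Longrightarrow>
      \<forall>w\<in>S. ball w 1 \<subseteq> D \<and> inj_on G (ball w 1) \<Longrightarrow> bounded_distortion C G S"
proof -
  obtain C where C: "0 < C" and Cb:
    "\<And>\<phi>. \<phi> holomorphic_on ball 0 1 \<Longrightarrow> inj_on \<phi> (ball 0 1) \<Longrightarrow> norm (deriv (deriv \<phi>) 0) \<le> C * norm (deriv \<phi> 0)"
    using univalent_second_derivative_bound by blast
  have main: "bounded_distortion C G S"
    if D: "open D" "G holomorphic_on D" and S: "open S" "convex S"
      and B': "\<forall>w\<in>S. ball w 1 \<subseteq> D \<and> inj_on G (ball w 1)" for G D S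
    unfolding bounded_distortion_def
  proof (intro ballI)
    fix x y assume xy: "x \<in> S" "y \<in> S"
    note B = B'[rule_format]
    have SD: "S \<subseteq> D" using B by force
    have dG: "deriv G holomorphic_on D"
      using D by (simp add: holomorphic_deriv)
    have bnd: "norm (deriv (deriv G) w) \<le> C * norm (deriv G w)" and nz: "deriv G w \<noteq> 0" if w: "w \<in> S" for w
    proof -
      let ?\<phi> = "\<lambda>v. G (w + v)"
      have wB: "w + v \<in> ball w 1" if "v \<in> ball 0 1" for v :: complex
        using that by (simp add: dist_norm)
      have i: "inj_on ?\<phi> (ball 0 1)"
      proof (rule inj_onI)
        fix u v :: complex assume "u \<in> ball 0 1" "v \<in> ball 0 1" "G (w + u) = G (w + v)"
        then have "w + u = w + v" using B[OF w] wB by (meson inj_onD)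
        then show "u = v" by simp
      qed
      have h: "?\<phi> holomorphic_on ball 0 1"
      proof (rule holomorphic_on_compose_gen[OF _ D(2), unfolded o_def])
        show "(+) w ` ball 0 1 \<subseteq> D"
          using B[OF w] wB by blast
      qed (auto intro!: holomorphic_intros)
      have sh: "deriv (\<lambda>v. H (w + v)) v = deriv H (w + v)" for v and H :: "complex \<Rightarrow> complex"
        by (simp add: deriv_shift_0[of H "w + v"] deriv_shift_0[of "\<lambda>v. H (w + v)" v] o_def add.assoc)
      have "deriv ?\<phi> = (\<lambda>v. deriv G (w + v))" using sh by auto
      then have "deriv (deriv ?\<phi>) 0 = deriv (deriv G) w"
        using sh[of "deriv G" 0] by simp
      then show "norm (deriv (deriv G) w) \<le> C * norm (deriv G w)"
        using Cb[OF h i] sh[of G 0] by simp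
      have "inj_on G (ball w 1)" "G holomorphic_on ball w 1"
        using B[OF w] D by (auto intro: holomorphic_on_subset)
      then show "deriv G w \<noteq> 0"
        using holomorphic_injective_imp_regular[of G "ball w 1" w] by simp
    qed
    obtain l where l: "l holomorphic_on S" "\<And>z. z \<in> S \<Longrightarrow> deriv G z = exp (l z)"
      using contractible_imp_holomorphic_log[OF holomorphic_on_subset[OF dG SD]
          convex_imp_contractible[OF S(2)] nz] by blast
    have dl: "norm (deriv l z) \<le> C" if z: "z \<in> S" for z
    proof -
      have "(l has_field_derivative deriv l z) (at z)"
        using l(1) S(1) z by (simp add: holomorphic_derivI)
      then have "((\<lambda>z. exp (l z)) has_field_derivative exp (l z) * deriv l z) (at z)"
        by (auto intro!: derivative_eq_intros)
      then have "(deriv G has_field_derivative exp (l z) * deriv l z) (at z)"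
        by (rule has_field_derivative_transform_within_open[OF _ S(1) z]) (use l in auto)
      then have "deriv (deriv G) z = deriv G z * deriv l z"
        using l(2)[OF z] by (simp add: DERIV_imp_deriv)
      then show ?thesis using bnd[OF z] nz[OF z] by (simp add: norm_mult mult.commute)
    qed
    have "norm (l x - l y) \<le> C * norm (x - y)"
    proof (rule field_differentiable_bound[OF S(2)])
      show "(l has_field_derivative deriv l z) (at z within S)" if "z \<in> S" for z
        using that l(1) S(1) by (simp add: holomorphic_derivI)
    qed (use dl xy in auto)
    then have "Re (l x) \<le> C * dist x y + Re (l y)"
      using complex_Re_le_cmod[of "l x - l y"] unfolding dist_norm by simp
    then have "exp (Re (l x)) \<le> exp (C * dist x y) * exp (Re (l y))"
      by (metis exp_add exp_le_cancel_iff)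
    then show "norm (deriv G x) \<le> exp (C * dist x y) * norm (deriv G y)"
      using l(2) xy by simp
  qed
  show ?thesis
    by (rule that[OF C]) (rule main; assumption)
qed

section \<open>The filled Julia set of a polynomial\<close>

lemma two_power_at_top: "filterlim (\<lambda>n. (2::real) ^ n) at_top sequentially"
proof (rule filterlim_at_top_mono[OF filterlim_real_sequentially])
  show "\<forall>\<^sub>F n in sequentially. real n \<le> 2 ^ n"
    using of_nat_less_two_power[where 'a = real] less_imp_le by (auto intro!: always_eventually)
qed

lemma poly_escape_radius:
  fixes p :: "complex poly"
  assumes "degree p \<ge> 2"
  obtains R where "R \<ge> 1" "\<And>z. norm z \<ge> R \<Longrightarrow> norm (poly p z) \<ge> 2 * norm z"
proof -
  obtain a q where p: "p = pCons a q" by (cases p)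
  obtain b s where q: "q = pCons b s" by (cases q)
  have "s \<noteq> 0" using assms by (auto simp: p q split: if_splits)
  then obtain r where r: "\<And>z. norm z \<ge> r \<Longrightarrow> 3 \<le> norm (poly q z)"
    using poly_infinity[of s 3 b] q by blast
  show ?thesis
  proof (rule that[of "max 1 (max r (norm a))"])
    fix z :: complex assume z: "norm z \<ge> max 1 (max r (norm a))"
    then have "norm z * 3 \<le> norm z * norm (poly q z)"
      by (intro mult_left_mono r) auto
    also have "\<dots> = norm (poly p z - a)" by (simp add: p norm_mult)
    also have "\<dots> \<le> norm (poly p z) + norm a" by (rule norm_triangle_ineq4)
    finally show "norm (poly p z) \<ge> 2 * norm z" using z by simp
  qed simp
qed

text \<open>
  \<open>R\<close> is an escape radius: outside the disc of radius \<open>R\<close> each step at least doubles the modulus.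
\<close>

locale poly_dynamics =
  fixes p :: "complex poly" and R :: real
  assumes deg: "degree p \<ge> 2"
    and R1: "R \<ge> 1" and esc: "\<And>z. norm z \<ge> R \<Longrightarrow> norm (poly p z) \<ge> 2 * norm z"
begin

abbreviation "K \<equiv> filled_Julia_set p"

lemma holomorphic_iter [holomorphic_intros]:
  "g holomorphic_on A \<Longrightarrow> (\<lambda>z. (poly p ^^ n) (g z)) holomorphic_on A"
  by (induction n) (auto intro!: holomorphic_intros)

lemma continuous_iter: "continuous_on A (poly p ^^ n)"
  using holomorphic_iter[of "\<lambda>z. z" A n] by (simp add: holomorphic_on_imp_continuous_on)

lemma iter_escape: "norm z \<ge> R \<Longrightarrow> norm ((poly p ^^ n) z) \<ge> 2 ^ n * norm z"
proof (induction n)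
  case (Suc n)
  have "1 * norm z \<le> 2 ^ n * norm z"
    by (intro mult_right_mono) auto
  then have "R \<le> norm ((poly p ^^ n) z)" using Suc by linarith
  from esc[OF this] show ?case using Suc by simp
qed auto

lemma iter_le_imp_le:
  assumes "norm ((poly p ^^ n) z) \<le> M" "R \<le> M"
  shows "norm z \<le> M"
proof (rule ccontr)
  assume *: "\<not> ?thesis"
  have "1 * norm z \<le> 2 ^ n * norm z"
    by (intro mult_right_mono) auto
  then show False using * assms iter_escape[of z n] by linarith
qed

lemma escape_if: assumes "norm ((poly p ^^ m) z) \<ge> R" shows "z \<notin> K"
proof -
  have R: "0 < norm ((poly p ^^ m) z)" using assms R1 by linarith
  have "filterlim (\<lambda>n. norm ((poly p ^^ (n + m)) z)) at_top sequentially"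
  proof (rule filterlim_at_top_mono)
    show "\<forall>\<^sub>F n in sequentially. 2 ^ n * norm ((poly p ^^ m) z) \<le> norm ((poly p ^^ (n + m)) z)"
      using iter_escape[OF assms] by (simp add: funpow_add)
    show "filterlim (\<lambda>n. 2 ^ n * norm ((poly p ^^ m) z)) at_top sequentially"
      using R by (intro filterlim_at_top_mult_tendsto_pos[OF tendsto_const _ two_power_at_top])
  qed
  then have "filterlim (\<lambda>n. (poly p ^^ (n + m)) z) at_infinity sequentially"
    by (simp add: filterlim_at_infinity_conv_norm_at_top)
  then have "filterlim (\<lambda>n. (poly p ^^ n) z) at_infinity sequentially"
    using eventually_sequentially_seg[of "\<lambda>n. P ((poly p ^^ n) z)" m for P] by (simp add: filterlim_iff)
  then show ?thesis by (simp add: filled_Julia_set_def)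
qed

lemma not_K_imp_escape: assumes "z \<notin> K" obtains m where "norm ((poly p ^^ m) z) \<ge> R"
proof -
  have "filterlim (\<lambda>n. norm ((poly p ^^ n) z)) at_top sequentially"
    using assms by (simp add: filled_Julia_set_def filterlim_at_infinity_conv_norm_at_top)
  then have "\<forall>\<^sub>F n in sequentially. R \<le> norm ((poly p ^^ n) z)"
    by (simp add: filterlim_at_top)
  then show ?thesis using that by (meson eventually_happens trivial_limit_sequentially)
qed

lemma K_bound: "z \<in> K \<Longrightarrow> norm ((poly p ^^ n) z) < R"
  using escape_if linorder_not_le by blast

lemma K_bound0: "z \<in> K \<Longrightarrow> norm z < R"
  using K_bound[of z 0] by simp

lemma K_eq: "K = {z. \<forall>n. norm ((poly p ^^ n) z) \<le> R}"
proof -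
  have "z \<in> K" if "\<forall>n. norm ((poly p ^^ n) z) \<le> R" for z
  proof (rule ccontr)
    assume "z \<notin> K"
    then obtain m where "norm ((poly p ^^ m) z) \<ge> R" using not_K_imp_escape by blast
    from esc[OF this] have "2 * R \<le> norm ((poly p ^^ Suc m) z)"
      using \<open>norm ((poly p ^^ m) z) \<ge> R\<close> by simp
    then show False using that[rule_format, of "Suc m"] R1 by linarith
  qed
  then show ?thesis using K_bound by (auto intro: less_imp_le)
qed

lemma iter_K_iff: "(poly p ^^ n) z \<in> K \<longleftrightarrow> z \<in> K"
proof
  assume "z \<in> K"
  then show "(poly p ^^ n) z \<in> K"
    using K_eq by (auto simp: funpow_add[symmetric, unfolded o_def, THEN fun_cong])
next
  assume *: "(poly p ^^ n) z \<in> K"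
  show "z \<in> K"
  proof (rule ccontr)
    assume "z \<notin> K"
    then obtain m where m: "norm ((poly p ^^ m) z) \<ge> R" using not_K_imp_escape by blast
    have "1 * norm ((poly p ^^ m) z) \<le> 2 ^ n * norm ((poly p ^^ m) z)"
      by (intro mult_right_mono) auto
    then have "R \<le> norm ((poly p ^^ n) ((poly p ^^ m) z))"
      using iter_escape[OF m, of n] m by linarith
    also have "(poly p ^^ n) ((poly p ^^ m) z) = (poly p ^^ m) ((poly p ^^ n) z)"
      by (simp add: funpow_add[symmetric, unfolded o_def, THEN fun_cong] add.commute)
    finally show False using escape_if * by blast
  qed
qed

lemma p_K_iff: "poly p z \<in> K \<longleftrightarrow> z \<in> K"
  using iter_K_iff[of 1 z] by simp

lemma closed_K: "closed K"
proof -
  have "closed {z. norm ((poly p ^^ n) z) \<le> R}" for n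
    by (intro closed_Collect_le continuous_intros continuous_iter)
  then show ?thesis unfolding K_eq Collect_all_eq by auto
qed

lemma bounded_K: "bounded K"
  using K_bound0 by (auto simp: bounded_iff intro: less_imp_le)

text \<open>
  A bounded component of the complement would have its frontier in \<open>K\<close>, and the maximum principle for all
  iterates would put the component itself into \<open>K\<close>.
\<close>

lemma connected_basin: "connected (- K)"
proof (rule ccontr)
  assume "\<not> connected (- K)"
  then obtain C where C: "C \<in> components (- K)" "bounded C"
    using cobounded_has_bounded_component[of "- K"] bounded_K by auto
  have oC: "open C" using C closed_K open_components by blast
  have fr: "frontier C \<subseteq> K"
    using frontier_of_components_closed_complement[OF closed_K C(1)] frontier_subset_closed[OF closed_K] by blast
  obtain z where z: "z \<in> C" using C in_components_nonempty by blast
  have "norm ((poly p ^^ n) z) \<le> R" for n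
  proof (rule maximum_modulus_frontier[of "poly p ^^ n" C])
    show "poly p ^^ n holomorphic_on interior C"
      using holomorphic_iter[of "\<lambda>z. z"] by simp
    show "\<And>z. z \<in> frontier C \<Longrightarrow> norm ((poly p ^^ n) z) \<le> R"
      using fr K_bound less_imp_le by blast
  qed (use C z continuous_iter in auto)
  then have "z \<in> K" by (simp add: K_eq)
  then show False using C z in_components_subset by blast
qed

text \<open>
  Near an escaping point the iterates tend to infinity uniformly. A sequence of iterates may repeat a
  single one infinitely often, and then it has a constant subsequence; otherwise its exponents tend
  to infinity.
\<close>

lemma Julia_subset_K: "Julia_set p \<subseteq> K"
proof -
  have "normal_at {poly p ^^ n |n. True} z" if z: "z \<notin> K" for z
  proof -
    obtain m where m: "norm ((poly p ^^ m) z) \<ge> R" using not_K_imp_escape[OF z] .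
    have "2 * R \<le> norm ((poly p ^^ Suc m) z)"
      using esc[OF m] m by simp
    then have m1: "R < norm ((poly p ^^ Suc m) z)" using R1 by linarith
    define U where "U = {w. R < norm ((poly p ^^ Suc m) w)}"
    have U: "open U" "z \<in> U"
      using m1 unfolding U_def
      by (auto intro!: open_Collect_less continuous_intros continuous_iter simp del: funpow.simps)
    have esc_unif: "\<forall>\<^sub>F n in sequentially. \<forall>w\<in>U. B \<le> norm ((poly p ^^ n) w)" for B
    proof -
      have "\<forall>\<^sub>F n in sequentially. max B 0 \<le> 2 ^ n"
        using two_power_at_top unfolding filterlim_at_top by blast
      then obtain N where N: "\<And>n. n \<ge> N \<Longrightarrow> max B 0 \<le> 2 ^ n"
        unfolding eventually_sequentially by blast
      have "B \<le> norm ((poly p ^^ n) w)" if n: "n \<ge> N + Suc m" and w: "w \<in> U" for n w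
      proof -
        have "max B 0 * 1 \<le> 2 ^ (n - Suc m) * norm ((poly p ^^ Suc m) w)"
          using w R1 N[of "n - Suc m"] n unfolding U_def by (intro mult_mono) auto
        also have "\<dots> \<le> norm ((poly p ^^ (n - Suc m)) ((poly p ^^ Suc m) w))"
          using w unfolding U_def by (intro iter_escape) auto
        also have "(poly p ^^ (n - Suc m)) ((poly p ^^ Suc m) w) = (poly p ^^ (n - Suc m + Suc m)) w"
          by (simp only: funpow_add o_apply)
        also have "n - Suc m + Suc m = n" using n by simp
        finally show ?thesis by simp
      qed
      then show ?thesis unfolding eventually_sequentially by blast
    qed
    have "normal_family_on U {poly p ^^ n |n. True}"
      unfolding normal_family_on_def
    proof (intro allI impI)
      fix s :: "nat \<Rightarrow> complex \<Rightarrow> complex"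
      assume "range s \<subseteq> {poly p ^^ n |n. True}"
      then have "\<forall>k. \<exists>n. s k = poly p ^^ n" by blast
      then obtain t where t: "\<And>k. s k = poly p ^^ t k" by metis
      show "\<exists>r. strict_mono r \<and>
           ((\<exists>g. g holomorphic_on U \<and>
               (\<forall>C. compact C \<and> C \<subseteq> U \<longrightarrow> uniform_limit C (\<lambda>n. s (r n)) g sequentially)) \<or>
            (\<forall>C. compact C \<and> C \<subseteq> U \<longrightarrow>
               (\<forall>B. \<forall>\<^sub>F n in sequentially. \<forall>z\<in>C. B \<le> norm (s (r n) z))))"
      proof (cases "\<exists>c. infinite {k. t k = c}")
        case True
        then obtain c where c: "infinite {k. t k = c}" by blast
        define r where "r = enumerate {k. t k = c}"
        have r: "strict_mono r" "t (r n) = c" for n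
          using c enumerate_in_set[OF c, of n] by (auto simp: r_def strict_mono_enumerate)
        have "poly p ^^ c holomorphic_on U"
          using holomorphic_iter[of "\<lambda>z. z"] by simp
        moreover have "uniform_limit C (\<lambda>n. s (r n)) (poly p ^^ c) sequentially" for C
          unfolding t r(2) by (rule uniform_limit_const)
        ultimately show ?thesis using r(1) by blast
      next
        case False
        have "filterlim t at_top sequentially"
          unfolding filterlim_at_top
        proof
          fix B
          have "{k. \<not> B \<le> t k} = (\<Union>c<B. {k. t k = c})" by auto
          then have "finite {k. \<not> B \<le> t k}" using False by auto
          then show "\<forall>\<^sub>F k in sequentially. B \<le> t k"
            by (simp add: eventually_cofinite flip: cofinite_eq_sequentially)
        qed
        then have "\<forall>\<^sub>F k in sequentially. \<forall>w\<in>U. B \<le> norm ((poly p ^^ t k) w)" for B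
          using eventually_compose_filterlim[OF esc_unif] by blast
        then have "\<forall>\<^sub>F k in sequentially. \<forall>w\<in>C. B \<le> norm (s (id k) w)" if "C \<subseteq> U" for B C
          by (rule eventually_mono) (use that t in auto)
        then show ?thesis using strict_mono_id by blast
      qed
    qed
    then show ?thesis using U unfolding normal_at_def by blast
  qed
  then show ?thesis unfolding Julia_set_def by blast
qed

text \<open>
  Arbitrarily close to a point of the frontier there are points with unbounded orbits, while the orbit of the point
  itself is bounded; so no subsequence of the iterates converges near it, not even to infinity.
\<close>

lemma frontier_subset_Julia: "frontier K \<subseteq> Julia_set p"
proof
  fix z assume z: "z \<in> frontier K"
  have zK: "z \<in> K" using z closed_K frontier_subset_closed by blast
  show "z \<in> Julia_set p"
  proof (rule ccontr)
    assume "z \<notin> Julia_set p"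
    then obtain U where U: "open U" "z \<in> U" "normal_family_on U {poly p ^^ n |n. True}"
      by (auto simp: Julia_set_def normal_at_def)
    have "range (\<lambda>n. poly p ^^ n) \<subseteq> {poly p ^^ n |n. True}" by blast
    then obtain r where r: "strict_mono (r :: nat \<Rightarrow> nat)" and
      alt: "(\<exists>g. g holomorphic_on U \<and>
               (\<forall>C. compact C \<and> C \<subseteq> U \<longrightarrow> uniform_limit C (\<lambda>n. poly p ^^ (r n)) g sequentially)) \<or>
            (\<forall>C. compact C \<and> C \<subseteq> U \<longrightarrow>
               (\<forall>B. \<forall>\<^sub>F n in sequentially. \<forall>z\<in>C. B \<le> norm ((poly p ^^ (r n)) z)))"
      using U(3)[unfolded normal_family_on_def, rule_format, of "\<lambda>n. poly p ^^ n"] by blast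
    from alt show False
    proof
      assume "\<exists>g. g holomorphic_on U \<and>
               (\<forall>C. compact C \<and> C \<subseteq> U \<longrightarrow> uniform_limit C (\<lambda>n. poly p ^^ (r n)) g sequentially)"
      then obtain g where g: "\<And>C. compact C \<Longrightarrow> C \<subseteq> U \<Longrightarrow> uniform_limit C (\<lambda>n. poly p ^^ (r n)) g sequentially"
        by blast
      have "z \<in> closure (- K)" using z by (simp add: frontier_closures)
      then obtain w where w: "w \<in> - K" "w \<in> U"
        using U by (meson open_Int_closure_eq_empty disjoint_iff)
      have "(\<lambda>n. (poly p ^^ (r n)) w) \<longlonglongrightarrow> g w"
        using tendsto_uniform_limitI[OF g[of "{w}"]] w by auto
      moreover have "filterlim (\<lambda>n. (poly p ^^ (r n)) w) at_infinity sequentially"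
        using w filterlim_compose[OF _ filterlim_subseq[OF r]]
        by (auto simp: filled_Julia_set_def)
      ultimately show False
        using not_tendsto_and_filterlim_at_infinity trivial_limit_sequentially by blast
    next
      assume "\<forall>C. compact C \<and> C \<subseteq> U \<longrightarrow>
               (\<forall>B. \<forall>\<^sub>F n in sequentially. \<forall>z\<in>C. B \<le> norm ((poly p ^^ (r n)) z))"
      then have "\<forall>\<^sub>F n in sequentially. R \<le> norm ((poly p ^^ (r n)) z)"
        using U(2) by (auto dest!: spec[of _ "{z}"])
      then obtain n where "R \<le> norm ((poly p ^^ (r n)) z)"
        by (meson eventually_happens trivial_limit_sequentially)
      then show False using K_bound[OF zK, of "r n"] by simp
    qed
  qed
qed

text \<open>
  The Julia set lies in \<open>K\<close> and contains its frontier. If \<open>K\<close> were separated into two closed pieces, the Julia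
  set would lie in one of them, and the other, having no frontier, would be open, closed and bounded.
\<close>

lemma connected_K:
  assumes J: "connected (Julia_set p)"
  shows "connected K"
proof (rule ccontr)
  assume "\<not> connected K"
  then obtain A B where AB: "closed A" "closed B" "K = A \<union> B" "A \<noteq> {}" "B \<noteq> {}" "A \<inter> B = {}"
    using connected_closed_set[OF closed_K] by auto
  have clopen: False
    if A: "closed A" and B: "closed B" and K: "K = A \<union> B" and ne: "B \<noteq> {}" and AB: "A \<inter> B = {}" and JA: "Julia_set p \<subseteq> A" for A B
  proof -
    have "frontier K = K - interior K"
      using closed_K by (simp add: frontier_def)
    then have "B = interior K - A"
      using frontier_subset_Julia JA K AB interior_subset[of K] by blast
    moreover have "open (interior K - A)" using A by (intro open_Diff) auto
    ultimately have "open B" by simp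
    then have "B = UNIV" using B ne clopen[of B] by blast
    then show False using K bounded_K not_bounded_UNIV[where 'a=complex] by (simp add: Un_commute)
  qed
  have "Julia_set p \<subseteq> A \<or> Julia_set p \<subseteq> B"
    using J Julia_subset_K AB unfolding connected_closed by blast
  then show False
    using clopen[of A B] clopen[of B A] AB by (auto simp: Un_commute Int_commute)
qed

end

section \<open>Simple connectivity of the basin of infinity\<close>

context poly_dynamics
begin

text \<open>
  The complement of \<open>K\<close> in the sphere, moved into the plane by \<open>z \<mapsto> 1 / (z - z0)\<close>. The point 0 represents
  infinity and has to be added by hand, since \<open>1 / 0 = 0\<close>.
\<close>

definition inverted_basin :: "complex \<Rightarrow> complex set" where
  "inverted_basin z0 = {w. w = 0 \<or> z0 + 1 / w \<notin> K}"

lemma inverted_basin_eq_Un: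
  "inverted_basin z0 = {w. w \<noteq> 0 \<and> z0 + 1 / w \<in> - K} \<union> ball 0 (1 / (R + norm z0))"
proof -
  have "z0 + 1 / w \<notin> K" if w: "w \<in> ball 0 (1 / (R + norm z0))" "w \<noteq> 0" for w
  proof
    assume K: "z0 + 1 / w \<in> K"
    have Rz: "0 < R + norm z0" using R1 by (simp add: add_pos_nonneg)
    have "R + norm z0 < 1 / norm w"
      using w Rz by (simp add: less_divide_eq mult.commute)
    also have "1 / norm w = norm (z0 + 1 / w - z0)" by (simp add: norm_divide)
    also have "\<dots> \<le> norm (z0 + 1 / w) + norm z0" by (rule norm_triangle_ineq4)
    finally show False using K_bound0[OF K] by simp
  qed
  moreover have "0 < R + norm z0" using R1 by (simp add: add_pos_nonneg)
  ultimately show ?thesis unfolding inverted_basin_def by auto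
qed

lemma open_punctured_inverted_basin: "open {w. w \<noteq> 0 \<and> z0 + 1 / w \<in> - K}"
proof -
  have "open ((- {0}) \<inter> (\<lambda>w. z0 + 1 / w) -` (- K))"
    using closed_K by (intro continuous_open_preimage) (auto intro!: continuous_intros)
  also have "(- {0}) \<inter> (\<lambda>w. z0 + 1 / w) -` (- K) = {w. w \<noteq> 0 \<and> z0 + 1 / w \<in> - K}" by auto
  finally show ?thesis .
qed

lemma open_inverted_basin: "open (inverted_basin z0)"
  unfolding inverted_basin_eq_Un by (intro open_Un open_punctured_inverted_basin open_ball)

lemma connected_inverted_basin:
  assumes "z0 \<in> K"
  shows "connected (inverted_basin z0)"
proof -
  have Rz: "0 < R + norm z0" using R1 by (simp add: add_pos_nonneg)
  have im: "{w. w \<noteq> 0 \<and> z0 + 1 / w \<in> - K} = (\<lambda>z. 1 / (z - z0)) ` (- K)"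
  proof (intro equalityI subsetI)
    fix w assume "w \<in> {w. w \<noteq> 0 \<and> z0 + 1 / w \<in> - K}"
    then show "w \<in> (\<lambda>z. 1 / (z - z0)) ` (- K)"
      by (intro image_eqI[of _ _ "z0 + 1 / w"]) auto
  qed (use assms in auto)
  have "connected {w. w \<noteq> 0 \<and> z0 + 1 / w \<in> - K}"
    unfolding im using assms
    by (intro connected_continuous_image connected_basin) (auto intro!: continuous_intros)
  moreover have "{w. w \<noteq> 0 \<and> z0 + 1 / w \<in> - K} \<inter> ball 0 (1 / (R + norm z0)) \<noteq> {}"
  proof -
    define e where "e = 1 / (R + norm z0)"
    define w :: complex where "w = of_real (e / 2)"
    have "0 < e" using Rz by (simp add: e_def)
    then have "w \<noteq> 0" "w \<in> ball 0 (1 / (R + norm z0))"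
      by (auto simp: w_def norm_divide simp flip: e_def)
    moreover from this have "w \<in> inverted_basin z0" unfolding inverted_basin_eq_Un by blast
    ultimately show ?thesis unfolding inverted_basin_def by blast
  qed
  ultimately show ?thesis
    unfolding inverted_basin_eq_Un by (intro connected_Un) auto
qed

text \<open>
  For a closed path in the inverted basin, the winding number about \<open>1 / (a - z0)\<close> is locally constant in \<open>a \<in> K\<close> and
  vanishes for \<open>a\<close> near \<open>z0\<close>, where \<open>1 / (a - z0)\<close> is large. As \<open>K\<close> is connected, it vanishes everywhere.
\<close>

lemma simply_connected_inverted_basin:
  assumes K: "connected K" and z0: "z0 \<in> K"
  shows "simply_connected (inverted_basin z0)"
proof -
  have "winding_number g z = 0"
    if g: "path g" "path_image g \<subseteq> inverted_basin z0" "pathfinish g = pathstart g" and z: "z \<notin> inverted_basin z0" for g z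
  proof -
    obtain B where B: "\<And>y. B \<le> norm y \<Longrightarrow> winding_number g y = 0"
      using winding_number_zero_at_infinity[OF g(1,3)] by blast
    define B' where "B' = max B 1"
    have B'0: "0 < B'" by (simp add: B'_def)
    define W where "W k = {y. y \<notin> path_image g \<and> winding_number g y = k}" for k
    have oW: "open (W k)" for k
      unfolding W_def by (rule open_winding_number_levelsets[OF g(1,3)])
    have pre: "open {a. a \<noteq> z0 \<and> 1 / (a - z0) \<in> V}" if "open V" for V :: "complex set"
    proof -
      have "open ((- {z0}) \<inter> (\<lambda>a. 1 / (a - z0)) -` V)"
        using that by (intro continuous_open_preimage) (auto intro!: continuous_intros)
      also have "(- {z0}) \<inter> (\<lambda>a. 1 / (a - z0)) -` V = {a. a \<noteq> z0 \<and> 1 / (a - z0) \<in> V}" by auto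
      finally show ?thesis .
    qed
    \<comment> \<open>\<open>U1\<close> and \<open>U2\<close> separate the points of \<open>K\<close> with nonzero and with zero winding number; \<open>U2\<close> contains \<open>z0\<close>.\<close>
    define U1 where "U1 = {a. a \<noteq> z0 \<and> 1 / (a - z0) \<in> (\<Union>k\<in>-{0}. W k)}"
    define U2 where "U2 = {a. a \<noteq> z0 \<and> 1 / (a - z0) \<in> W 0} \<union> ball z0 (1 / B')"
    have o: "open U1" "open U2"
      unfolding U1_def U2_def by (intro pre open_Un open_ball open_UN oW ballI)+
    have notin: "1 / (a - z0) \<notin> path_image g" if "a \<in> K" "a \<noteq> z0" for a
      using that g(2) by (auto simp: inverted_basin_def)
    have cover: "K \<subseteq> U1 \<union> U2"
    proof
      fix a assume "a \<in> K"
      then show "a \<in> U1 \<union> U2"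
        using notin[of a] by (cases "a = z0") (auto simp: U1_def U2_def W_def B'_def)
    qed
    have disj: "U1 \<inter> U2 \<inter> K = {}"
    proof -
      have "winding_number g (1 / (a - z0)) = 0" if "a \<in> ball z0 (1 / B')" "a \<noteq> z0" for a
      proof (rule B)
        have "B' \<le> 1 / norm (a - z0)"
          using that B'0 by (simp add: dist_norm norm_minus_commute le_divide_eq less_divide_eq mult.commute)
        then show "B \<le> norm (1 / (a - z0))" by (simp add: B'_def norm_divide)
      qed
      then show ?thesis by (auto simp: U1_def U2_def W_def)
    qed
    have "z0 \<in> U2 \<inter> K" using z0 by (simp add: U2_def B'_def)
    then have U1: "U1 \<inter> K = {}"
      using connectedD[OF K o _ cover] disj by blast
    have "z \<noteq> 0" "z0 + 1 / z \<in> K" using z by (auto simp: inverted_basin_def)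
    then have "z0 + 1 / z \<notin> U1" using U1 by blast
    moreover have "z \<notin> path_image g" using z g(2) by blast
    ultimately show ?thesis using \<open>z \<noteq> 0\<close> by (auto simp: U1_def W_def)
  qed
  then show ?thesis
    using connected_inverted_basin[OF z0] by (subst simply_connected_eq_winding_number_zero[OF open_inverted_basin]) blast
qed

lemma Riemann_map_inverted_basin:
  assumes K: "connected K" and z0: "z0 \<in> K" and ne: "K \<noteq> {z0}"
  obtains f g where "f holomorphic_on inverted_basin z0" "g holomorphic_on ball 0 1"
    "\<And>w. w \<in> inverted_basin z0 \<Longrightarrow> f w \<in> ball 0 1 \<and> g (f w) = w"
    "\<And>t. t \<in> ball 0 1 \<Longrightarrow> g t \<in> inverted_basin z0 \<and> f (g t) = t" "f 0 = 0" "g 0 = 0"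
proof -
  obtain a where a: "a \<in> K" "a \<noteq> z0" using z0 ne by blast
  have 0: "0 \<in> inverted_basin z0" by (simp add: inverted_basin_def)
  have "inverted_basin z0 \<noteq> UNIV"
  proof
    assume "inverted_basin z0 = UNIV"
    then have "1 / (a - z0) \<in> inverted_basin z0" by simp
    then show False using a by (simp add: inverted_basin_def)
  qed
  then obtain F G where F: "F holomorphic_on inverted_basin z0" and G: "G holomorphic_on ball 0 1"
    and FG: "\<forall>z \<in> inverted_basin z0. F z \<in> ball 0 1 \<and> G (F z) = z" and GF: "\<forall>z \<in> ball 0 1. G z \<in> inverted_basin z0 \<and> F (G z) = z"
    using Riemann_mapping_theorem[of "inverted_basin z0"] simply_connected_inverted_basin[OF K z0] open_inverted_basin 0 by blast
  have "F 0 \<in> ball 0 1" using FG 0 by blast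
  then obtain f' g' where m: "f' (F 0) = 0" "f' holomorphic_on ball 0 1" "f' ` ball 0 1 \<subseteq> ball 0 1"
     "g' holomorphic_on ball 0 1" "g' ` ball 0 1 \<subseteq> ball 0 1"
     "\<And>z. z \<in> ball 0 1 \<Longrightarrow> f' (g' z) = z" "\<And>z. z \<in> ball 0 1 \<Longrightarrow> g' (f' z) = z"
    by (rule ball_biholomorphism_exists) (rule that; assumption)
  have fg: "f' z \<in> ball 0 1" "g' z \<in> ball 0 1" if "z \<in> ball 0 1" for z
    using m(3,5) that by blast+
  have g0: "g' 0 = F 0"
    using m(1) m(7)[of "F 0"] \<open>F 0 \<in> ball 0 1\<close> by simp
  show ?thesis
  proof (rule that[of "f' \<circ> F" "G \<circ> g'"])
    show "f' \<circ> F holomorphic_on inverted_basin z0"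
      by (rule holomorphic_on_compose_gen[OF F m(2)]) (use FG in blast)
    show "G \<circ> g' holomorphic_on ball 0 1"
      by (rule holomorphic_on_compose_gen[OF m(4) G m(5)])
    show "(f' \<circ> F) w \<in> ball 0 1 \<and> (G \<circ> g') ((f' \<circ> F) w) = w" if "w \<in> inverted_basin z0" for w
      using that FG m(7) fg by (metis comp_apply)
    show "(G \<circ> g') t \<in> inverted_basin z0 \<and> (f' \<circ> F) ((G \<circ> g') t) = t" if "t \<in> ball 0 1" for t
      using that GF m(6) fg by (metis comp_apply)
    show "(f' \<circ> F) 0 = 0" using m(1) by simp
    show "(G \<circ> g') 0 = 0" using FG 0 g0 by simp
  qed
qed

end

section \<open>Uniformization of the basin of infinity\<close>

text \<open>
  The maximum principle for functions that need not extend to the boundary of the disc.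
\<close>

lemma norm_le_1_if_boundary:
  assumes u: "u holomorphic_on ball 0 1"
    and bd: "\<And>e. 0 < e \<Longrightarrow> \<exists>s<1. \<forall>t. s < norm t \<and> norm t < 1 \<longrightarrow> norm (u t) \<le> 1 + e"
    and t: "t \<in> ball 0 1"
  shows "norm (u t :: complex) \<le> 1"
proof -
  have "norm (u t) \<le> 1 + e" if e: "0 < e" for e
  proof -
    obtain s where s: "s < 1" "\<And>t. s < norm t \<Longrightarrow> norm t < 1 \<Longrightarrow> norm (u t) \<le> 1 + e"
      using bd[OF e] by blast
    define m where "m = max s (norm t)"
    have "m < 1" using s(1) t by (simp add: m_def)
    then obtain r where r: "m < r" "r < 1" using dense by blast
    have r0: "0 < r" using r norm_ge_zero[of t] by (simp add: m_def del: norm_ge_zero)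
    show ?thesis
    proof (rule maximum_modulus_frontier[of u "ball 0 r"])
      show "u holomorphic_on interior (ball 0 r)"
        using r by (intro holomorphic_on_subset[OF u]) auto
      show "continuous_on (closure (ball 0 r)) u"
        using r r0 by (intro holomorphic_on_imp_continuous_on holomorphic_on_subset[OF u]) auto
      show "norm (u z) \<le> 1 + e" if "z \<in> frontier (ball 0 r)" for z
        using that r r0 s(2)[of z] by (simp add: m_def)
    qed (use r in \<open>auto simp: m_def\<close>)
  qed
  then show ?thesis by (simp add: field_le_epsilon)
qed

context poly_dynamics
begin

text \<open>
  In the inverted coordinate \<open>p\<close> becomes the rational function \<open>N w = w ^ d / r w\<close> with \<open>r 0 \<noteq> 0\<close>, which maps the
  inverted basin properly to itself and vanishes only at 0. Transported to the disc by the Riemann map it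
  becomes \<open>b t = t ^ d * u t\<close> with \<open>u\<close> free of zeros, and properness says that \<open>norm (b t)\<close> tends to 1 at the
  boundary. By the maximum principle \<open>u\<close> and \<open>1 / u\<close> are bounded by 1, so \<open>u\<close> is a constant of modulus 1.
\<close>

lemma basin_conjugate_to_power:
  assumes z0: "z0 \<in> K" and fix0: "poly p z0 = z0"
    and f: "f holomorphic_on inverted_basin z0" and g: "g holomorphic_on ball 0 1"
    and fg: "\<And>w. w \<in> inverted_basin z0 \<Longrightarrow> f w \<in> ball 0 1 \<and> g (f w) = w"
    and gf: "\<And>t. t \<in> ball 0 1 \<Longrightarrow> g t \<in> inverted_basin z0 \<and> f (g t) = t" and g0: "g 0 = 0"
  obtains c where "norm c = 1"
    "\<And>t. t \<in> ball 0 1 \<Longrightarrow> t \<noteq> 0 \<Longrightarrow> poly p (z0 + 1 / g t) = z0 + 1 / g (c * t ^ degree p)"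
proof -
  define d where "d = degree p"
  have d: "d \<ge> 2" using deg by (simp add: d_def)
  define q where "q = pcompose p [:z0, 1:] - [:z0:]"
  define r where "r = reflect_poly q"
  have pq: "poly q x = poly p (z0 + x) - z0" for x
    by (simp add: q_def poly_pcompose)
  have dpc: "degree (pcompose p [:z0, 1:]) = d" by (simp add: d_def degree_pcompose)
  have dq: "degree q = d"
  proof -
    have "degree (pcompose p [:z0, 1:] + [:- z0:]) = degree (pcompose p [:z0, 1:])"
      using dpc d by (intro degree_add_eq_left) simp
    moreover have "q = pcompose p [:z0, 1:] + [:- z0:]" by (simp add: q_def)
    ultimately show ?thesis using dpc by simp
  qed
  have q0: "q \<noteq> 0" using dq d by auto
  \<comment> \<open>\<open>N w = 1 / (p (z0 + 1 / w) - z0)\<close> for \<open>w \<noteq> 0\<close>; in this form it is visibly holomorphic at 0.\<close>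
  define N where "N w = w ^ d / poly r w" for w
  have rw: "poly r w = w ^ d * (poly p (z0 + 1 / w) - z0)" if "w \<noteq> 0" for w
    using poly_reflect_poly_nz[OF that, of q] by (simp add: r_def dq pq inverse_eq_divide)
  have r0: "poly r 0 \<noteq> 0" by (simp add: r_def q0)
  have rnz: "poly r w \<noteq> 0" if w: "w \<in> inverted_basin z0" for w
  proof (cases "w = 0")
    case False
    then have "poly p (z0 + 1 / w) \<notin> K" using w p_K_iff by (auto simp: inverted_basin_def)
    then have "poly p (z0 + 1 / w) \<noteq> z0" using z0 by auto
    then show ?thesis using rw[OF False] False by simp
  qed (use r0 in simp)
  have N1: "1 / N w = poly p (z0 + 1 / w) - z0" if "w \<noteq> 0" for w
    using rw[OF that] that by (simp add: N_def)
  have N0: "N 0 = 0" using d by (simp add: N_def)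
  have NOm: "N w \<in> inverted_basin z0" if w: "w \<in> inverted_basin z0" for w
  proof (cases "w = 0")
    case False
    then have "z0 + 1 / N w \<notin> K" using w p_K_iff N1[OF False] by (auto simp: inverted_basin_def)
    then show ?thesis by (simp add: inverted_basin_def)
  qed (simp add: N0 inverted_basin_def)
  define b where "b t = f (N (g t))" for t
  have b1: "b t \<in> ball 0 1" "g (b t) = N (g t)" if "t \<in> ball 0 1" for t
    using fg NOm gf that by (auto simp: b_def)
  obtain g1 where g1: "g1 holomorphic_on ball 0 1" "\<And>z. norm z < 1 \<Longrightarrow> g z = z * g1 z" "deriv g 0 = g1 0"
    using Schwarz3[OF g g0] by metis
  have inj: "inj_on g (ball 0 1)"
    using gf by (metis inj_onI)
  have g1nz: "g1 t \<noteq> 0" if t: "t \<in> ball 0 1" for t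
  proof (cases "t = 0")
    case True
    then show ?thesis
      using holomorphic_injective_imp_regular[OF g open_ball inj, of 0] g1(3) by simp
  next
    case False
    then have "g t \<noteq> g 0" using inj t by (auto dest: inj_onD)
    then show ?thesis using g1(2)[of t] t g0 by auto
  qed
  have gnz: "g t \<noteq> 0" if "t \<in> ball 0 1" "t \<noteq> 0" for t
    using g1(2)[of t] g1nz[of t] that by simp
  have holN: "N holomorphic_on inverted_basin z0"
    unfolding N_def by (intro holomorphic_intros rnz)
  have holNg: "(\<lambda>t. N (g t)) holomorphic_on ball 0 1"
    using gf by (intro holomorphic_on_compose_gen[OF g holN, unfolded o_def]) blast
  have holb: "b holomorphic_on ball 0 1"
    unfolding b_def using gf NOm by (intro holomorphic_on_compose_gen[OF holNg f, unfolded o_def]) blast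
  \<comment> \<open>The factor left over from \<open>b t * g1 (b t) = g (b t) = N (g t) = t ^ d * g1 t ^ d / r (g t)\<close>.\<close>
  define u where "u t = g1 t ^ d / (poly r (g t) * g1 (b t))" for t
  have den: "poly r (g t) \<noteq> 0" "g1 (b t) \<noteq> 0" if "t \<in> ball 0 1" for t
    using that rnz gf g1nz b1 by auto
  have holg1b: "(\<lambda>t. g1 (b t)) holomorphic_on ball 0 1"
    using b1 by (intro holomorphic_on_compose_gen[OF holb g1(1), unfolded o_def]) blast
  have holu: "u holomorphic_on ball 0 1"
    unfolding u_def using den by (intro holomorphic_intros g1(1) g holg1b) auto
  have unz: "u t \<noteq> 0" if "t \<in> ball 0 1" for t
    using den[OF that] g1nz[OF that] by (simp add: u_def)
  have bu: "b t = t ^ d * u t" if t: "t \<in> ball 0 1" for t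
  proof -
    have "b t * g1 (b t) = N (g t)" using g1(2)[of "b t"] b1[OF t] by simp
    also have "\<dots> = t ^ d * g1 t ^ d / poly r (g t)"
      using g1(2)[of t] t by (simp add: N_def power_mult_distrib)
    finally show ?thesis using den[OF t] by (simp add: u_def field_simps)
  qed
  \<comment> \<open>The points of the inverted basin that \<open>N\<close> maps into a compact set \<open>Q\<close> form a compact set \<open>fst ` Z\<close>: the
    equation \<open>w ^ d = v * r w\<close> is closed in the pair \<open>(w, v)\<close>, and \<open>w\<close> stays bounded because \<open>z0 + 1 / w\<close>
    cannot approach the fixed point \<open>z0\<close> while its image stays away from \<open>z0\<close>.\<close>
  have proper: "\<exists>s'<1. \<forall>t. s' < norm t \<and> norm t < 1 \<longrightarrow> s < norm (b t)" if s: "s < 1" for s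
  proof -
    define Q where "Q = g ` cball 0 s"
    have Q: "compact Q" "Q \<subseteq> inverted_basin z0"
      using s gf g unfolding Q_def
      by (auto intro!: compact_continuous_image holomorphic_on_imp_continuous_on elim: holomorphic_on_subset)
    obtain V where V: "0 < V" "\<And>v. v \<in> Q \<Longrightarrow> norm v \<le> V"
      using compact_imp_bounded[OF Q(1)] by (auto simp: bounded_pos)
    have "continuous (at z0) (poly p)" by simp
    then obtain \<delta> where \<delta>: "0 < \<delta>" "\<And>z. norm (z - z0) < \<delta> \<Longrightarrow> norm (poly p z - z0) < 1 / V"
      using V(1) fix0 unfolding continuous_at_eps_delta dist_norm by (metis divide_pos_pos zero_less_one)
    define Z where "Z = {x. fst x \<in> cball 0 (1 / \<delta>) \<and> snd x \<in> Q \<and> fst x ^ d = snd x * poly r (fst x)}"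
    have "Z = (cball 0 (1 / \<delta>) \<times> Q) \<inter> {x. fst x ^ d = snd x * poly r (fst x)}"
      by (auto simp: Z_def)
    moreover have "closed {x :: complex \<times> complex. fst x ^ d = snd x * poly r (fst x)}"
      by (intro closed_Collect_eq continuous_intros)
    ultimately have "compact Z"
      using Q(1) by (auto intro!: compact_Int_closed compact_Times)
    then have "compact (fst ` Z)"
      by (intro compact_continuous_image continuous_intros)
    moreover have fZ: "fst ` Z \<subseteq> inverted_basin z0"
    proof
      fix w assume "w \<in> fst ` Z"
      then obtain v where v: "v \<in> Q" "w ^ d = v * poly r w" by (auto simp: Z_def)
      show "w \<in> inverted_basin z0"
      proof (cases "w = 0")
        case False
        then have nz: "poly r w \<noteq> 0" "v \<noteq> 0" using v by auto
        then have "v = N w" using v by (simp add: N_def)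
        then have "poly p (z0 + 1 / w) = z0 + 1 / v" using N1[OF False] by (simp add: algebra_simps)
        moreover have "z0 + 1 / v \<notin> K" using v(1) Q(2) nz by (auto simp: inverted_basin_def)
        ultimately show ?thesis using p_K_iff by (metis (mono_tags, lifting) inverted_basin_def mem_Collect_eq)
      qed (simp add: inverted_basin_def)
    qed
    ultimately have cf: "compact (f ` fst ` Z)"
      using compact_continuous_image[OF holomorphic_on_imp_continuous_on[OF holomorphic_on_subset[OF f]]] by blast
    have fball: "f ` fst ` Z \<subseteq> ball 0 1" using fZ fg by blast
    obtain s' where s': "s' < 1" "f ` fst ` Z \<subseteq> cball 0 s'"
    proof (cases "f ` fst ` Z = {}")
      case False
      then obtain y where "y \<in> f ` fst ` Z" "\<And>x. x \<in> f ` fst ` Z \<Longrightarrow> norm x \<le> norm y"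
        using continuous_attains_sup[of "f ` fst ` Z" norm] cf continuous_on_norm_id by blast
      then show ?thesis using fball by (intro that[of "norm y"] subsetI) (simp_all add: subset_iff del: image_iff)
    qed (auto intro!: that[of 0])
    have "s < norm (b t)" if t: "s' < norm t" "norm t < 1" for t
    proof (rule ccontr)
      assume "\<not> ?thesis"
      then have bt: "b t \<in> cball 0 s" by simp
      have tb: "t \<in> ball 0 1" using t by simp
      define w where "w = g t"
      have w: "w \<in> inverted_basin z0" "f w = t" using gf[OF tb] by (auto simp: w_def)
      have NQ: "N w \<in> Q" using b1[OF tb] bt by (auto simp: Q_def w_def intro!: image_eqI[of _ _ "b t"])
      have "norm w \<le> 1 / \<delta>"
      proof (cases "w = 0")
        case False
        have "N w \<noteq> 0" using rnz[OF w(1)] False by (simp add: N_def)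
        then have "1 / V \<le> norm (1 / N w)"
          using V(2)[OF NQ] V(1) by (simp add: norm_divide frac_le)
        also have "\<dots> = norm (poly p (z0 + 1 / w) - z0)" using N1[OF False] by simp
        finally have "\<not> norm ((z0 + 1 / w) - z0) < \<delta>" using \<delta>(2)[of "z0 + 1 / w"] by linarith
        then show ?thesis using False \<delta>(1) by (simp add: norm_divide field_simps)
      qed (use \<delta> in simp)
      then have "(w, N w) \<in> Z"
        using NQ rnz[OF w(1)] by (simp add: Z_def N_def)
      then have "w \<in> fst ` Z" by force
      then have "t \<in> cball 0 s'" using s'(2) w(2) by blast
      then show False using t by simp
    qed
    then show ?thesis using s'(1) by blast
  qed
  have u_le: "norm (u t) \<le> 1" if "t \<in> ball 0 1" for t
  proof (rule norm_le_1_if_boundary[OF holu _ that])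
    fix e :: real assume e: "0 < e"
    define s where "s = root d (1 / (1 + e))"
    have s: "s < 1" "s ^ d = 1 / (1 + e)" "0 < s"
      using e d by (auto simp: s_def real_root_gt_zero)
    have "norm (u t) \<le> 1 + e" if t: "s < norm t" "norm t < 1" for t
    proof -
      have "1 / (1 + e) * norm (u t) \<le> norm t ^ d * norm (u t)"
        using s t power_mono[of s "norm t" d] by (intro mult_right_mono) auto
      also have "\<dots> = norm (b t)" using bu[of t] t by (simp add: norm_mult norm_power)
      also have "\<dots> < 1" using b1(1)[of t] t by simp
      finally show ?thesis using e by (simp add: field_simps)
    qed
    then show "\<exists>s<1. \<forall>t. s < norm t \<and> norm t < 1 \<longrightarrow> norm (u t) \<le> 1 + e"
      using s by blast
  qed
  have u_ge: "norm (1 / u t) \<le> 1" if "t \<in> ball 0 1" for t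
  proof (rule norm_le_1_if_boundary[OF _ _ that])
    show "(\<lambda>t. 1 / u t) holomorphic_on ball 0 1"
      by (intro holomorphic_intros holu unz)
    fix e :: real assume e: "0 < e"
    obtain s' where s': "s' < 1" "\<And>t. s' < norm t \<Longrightarrow> norm t < 1 \<Longrightarrow> 1 / (1 + e) < norm (b t)"
      using proper[of "1 / (1 + e)"] e by auto
    have "norm (1 / u t) \<le> 1 + e" if t: "s' < norm t" "norm t < 1" for t
    proof -
      have "1 / (1 + e) < norm t ^ d * norm (u t)"
        using s'(2)[OF t] bu[of t] t by (simp add: norm_mult norm_power)
      also have "\<dots> \<le> 1 * norm (u t)"
        using t by (intro mult_right_mono power_le_one) auto
      finally have "1 / (1 + e) < norm (u t)" by simp
      then show ?thesis using e unz[of t] t by (simp add: norm_divide field_simps)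
    qed
    then show "\<exists>s<1. \<forall>t. s < norm t \<and> norm t < 1 \<longrightarrow> norm (1 / u t) \<le> 1 + e"
      using s' by blast
  qed
  have u1: "norm (u t) = 1" if "t \<in> ball 0 1" for t
    using u_le[OF that] u_ge[OF that] unz[OF that] by (simp add: norm_divide)
  have "u constant_on ball 0 1"
    by (rule maximum_modulus_principle[OF holu open_ball _ open_ball order_refl, of 0]) (use u1 in auto)
  then obtain c where c: "\<And>t. t \<in> ball 0 1 \<Longrightarrow> u t = c" unfolding constant_on_def by blast
  show ?thesis
  proof (rule that[of c])
    show "norm c = 1" using u1[of 0] c[of 0] by simp
    fix t :: complex assume t: "t \<in> ball 0 1" "t \<noteq> 0"
    have "g (c * t ^ degree p) = N (g t)"
      using b1(2)[OF t(1)] bu[OF t(1)] c[OF t(1)] by (simp add: d_def mult.commute)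
    then show "poly p (z0 + 1 / g t) = z0 + 1 / g (c * t ^ degree p)"
      using N1[OF gnz[OF t]] by simp
  qed
qed

text \<open>
  With \<open>t = \<kappa> * exp (- \<zeta>)\<close> the power map of the disc becomes multiplication by the degree on the right
  half-plane; \<open>\<kappa>\<close> absorbs the constant \<open>c\<close>. The last clause states that maps from convex sets into the basin
  lift through \<open>\<Psi>\<close>: in the disc coordinate they avoid 0 and therefore have a logarithm.
\<close>

lemma Boettcher_uniformization:
  assumes K: "connected K" and z0: "z0 \<in> K" and fix0: "poly p z0 = z0" and ne: "K \<noteq> {z0}"
  obtains \<Psi> where "\<Psi> holomorphic_on {\<zeta>. 0 < Re \<zeta>}" "\<Psi> ` {\<zeta>. 0 < Re \<zeta>} = - K"
    "\<And>\<zeta>. 0 < Re \<zeta> \<Longrightarrow> poly p (\<Psi> \<zeta>) = \<Psi> (of_nat (degree p) * \<zeta>)"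
    "\<And>\<zeta> (k::int). \<Psi> (\<zeta> + 2 * of_int k * of_real pi * \<i>) = \<Psi> \<zeta>"
    "\<And>\<zeta> \<zeta>'. 0 < Re \<zeta> \<Longrightarrow> 0 < Re \<zeta>' \<Longrightarrow> \<Psi> \<zeta> = \<Psi> \<zeta>' \<Longrightarrow> \<exists>k::int. \<zeta> = \<zeta>' + 2 * of_int k * of_real pi * \<i>"
    "\<And>q S. convex S \<Longrightarrow> q holomorphic_on S \<Longrightarrow> q ` S \<subseteq> - K \<Longrightarrow>
       \<exists>\<xi>. \<xi> holomorphic_on S \<and> (\<forall>x\<in>S. 0 < Re (\<xi> x) \<and> \<Psi> (\<xi> x) = q x)"
proof -
  let ?H = "{\<zeta>. 0 < Re \<zeta>}"
  obtain f g where f: "f holomorphic_on inverted_basin z0" and g: "g holomorphic_on ball 0 1"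
    and fg: "\<And>w. w \<in> inverted_basin z0 \<Longrightarrow> f w \<in> ball 0 1 \<and> g (f w) = w"
    and gf: "\<And>t. t \<in> ball 0 1 \<Longrightarrow> g t \<in> inverted_basin z0 \<and> f (g t) = t" and f0: "f 0 = 0" and g0: "g 0 = 0"
    using Riemann_map_inverted_basin[OF K z0 ne] by blast
  obtain c where c: "norm c = 1"
    "\<And>t. t \<in> ball 0 1 \<Longrightarrow> t \<noteq> 0 \<Longrightarrow> poly p (z0 + 1 / g t) = z0 + 1 / g (c * t ^ degree p)"
    using basin_conjugate_to_power[OF z0 fix0 f g fg gf g0] by metis
  define d where "d = degree p"
  \<comment> \<open>A solution of \<open>c * \<kappa> ^ d = \<kappa>\<close>, so that the substitution removes the constant \<open>c\<close>.\<close>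
  define \<kappa> where "\<kappa> = exp (- Ln c / of_nat (d - 1))"
  have d: "d \<ge> 2" using deg by (simp add: d_def)
  have c0: "c \<noteq> 0" using c(1) by auto
  have "\<kappa> ^ (d - 1) = exp (of_nat (d - 1) * (- Ln c / of_nat (d - 1)))"
    unfolding \<kappa>_def by (rule exp_of_nat_mult[symmetric])
  also have "\<dots> = exp (- Ln c)" using d by simp
  also have "\<dots> = inverse c" using c0 by (simp add: exp_minus)
  finally have "c * (\<kappa> ^ (d - 1) * \<kappa>) = \<kappa>" using c0 by simp
  moreover have "\<kappa> ^ (d - 1) * \<kappa> = \<kappa> ^ d" using d by (metis One_nat_def Suc_1 Suc_le_lessD Suc_pred' less_le_trans power_Suc2 zero_less_Suc)
  ultimately have \<kappa>d: "c * \<kappa> ^ d = \<kappa>" by metis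
  have "norm \<kappa> = exp (Re (- Ln c / of_nat (d - 1)))" by (simp add: \<kappa>_def)
  also have "Re (- Ln c / of_nat (d - 1)) = 0" using c by (simp add: c0)
  finally have \<kappa>1: "norm \<kappa> = 1" by simp
  then have \<kappa>0: "\<kappa> \<noteq> 0" by auto
  define e where "e \<zeta> = \<kappa> * exp (- \<zeta>)" for \<zeta>
  have eb: "e \<zeta> \<in> ball 0 1" "e \<zeta> \<noteq> 0" if "0 < Re \<zeta>" for \<zeta>
    using that \<kappa>1 \<kappa>0 by (auto simp: e_def norm_mult)
  have gnz: "g t \<noteq> 0" if "t \<in> ball 0 1" "t \<noteq> 0" for t
    using that gf[of t] f0 by auto
  define \<Psi> where "\<Psi> \<zeta> = z0 + 1 / g (e \<zeta>)" for \<zeta>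
  have hole: "e holomorphic_on A" for A
    unfolding e_def by (intro holomorphic_intros)
  have holge: "(\<lambda>\<zeta>. g (e \<zeta>)) holomorphic_on ?H"
    using eb by (intro holomorphic_on_compose_gen[OF hole g, unfolded o_def]) blast
  have hol: "\<Psi> holomorphic_on ?H"
    unfolding \<Psi>_def using gnz[OF eb] by (intro holomorphic_intros holge) auto
  have lift: "\<exists>\<xi>. \<xi> holomorphic_on S \<and> (\<forall>x\<in>S. 0 < Re (\<xi> x) \<and> \<Psi> (\<xi> x) = q x)"
    if S: "convex S" and q: "q holomorphic_on S" "q ` S \<subseteq> - K" for q S
  proof -
    define h where "h x = f (1 / (q x - z0)) / \<kappa>" for x
    have qz: "q x \<noteq> z0" "1 / (q x - z0) \<in> inverted_basin z0" if "x \<in> S" for x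
      using q(2) z0 that by (auto simp: inverted_basin_def)
    have "(\<lambda>x. f (1 / (q x - z0))) holomorphic_on S"
      using qz by (intro holomorphic_on_compose_gen[OF _ f, unfolded o_def] holomorphic_intros q) auto
    then have "h holomorphic_on S" unfolding h_def using \<kappa>0 by (intro holomorphic_intros) auto
    moreover have hnz: "h x \<noteq> 0" if x: "x \<in> S" for x
    proof
      assume "h x = 0"
      then have "f (1 / (q x - z0)) = 0" using \<kappa>0 by (simp add: h_def)
      then have "1 / (q x - z0) = 0" using fg[OF qz(2)[OF x]] g0 by simp
      then show False using qz(1)[OF x] by simp
    qed
    ultimately obtain \<xi> where \<xi>: "\<xi> holomorphic_on S" "\<And>x. x \<in> S \<Longrightarrow> h x = exp (\<xi> x)"
      using contractible_imp_holomorphic_log[OF _ convex_imp_contractible[OF S]] by blast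
    have "0 < Re (- \<xi> x) \<and> \<Psi> (- \<xi> x) = q x" if x: "x \<in> S" for x
    proof -
      have ee: "e (- \<xi> x) = f (1 / (q x - z0))"
        using \<xi>(2)[OF x] \<kappa>0 by (simp add: e_def h_def field_simps)
      have "exp (Re (\<xi> x)) = norm (h x)" using \<xi>(2)[OF x] by simp
      also have "\<dots> < 1" using fg[OF qz(2)[OF x]] \<kappa>1 by (simp add: h_def norm_divide)
      finally have "Re (\<xi> x) < 0" by simp
      moreover have "\<Psi> (- \<xi> x) = q x"
        using fg[OF qz(2)[OF x]] by (simp add: \<Psi>_def ee)
      ultimately show ?thesis by simp
    qed
    then show ?thesis using \<xi>(1) by (intro exI[of _ "\<lambda>x. - \<xi> x"]) (auto intro!: holomorphic_intros)
  qed
  show ?thesis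
  proof (rule that[OF hol _ _ _ _ lift])
    show "\<Psi> ` ?H = - K"
    proof (intro equalityI subsetI)
      fix w assume "w \<in> \<Psi> ` ?H"
      then obtain \<zeta> where \<zeta>: "0 < Re \<zeta>" "w = \<Psi> \<zeta>" by blast
      then show "w \<in> - K"
        using gf[OF eb(1)[OF \<zeta>(1)]] gnz[OF eb[OF \<zeta>(1)]] by (auto simp: \<Psi>_def inverted_basin_def)
    next
      fix w assume w: "w \<in> - K"
      obtain \<xi> where "0 < Re (\<xi> 0)" "\<Psi> (\<xi> 0) = w"
        using lift[of "{0}" "\<lambda>_. w"] w by (auto simp: holomorphic_on_def)
      then show "w \<in> \<Psi> ` ?H" by (intro image_eqI[of _ _ "\<xi> 0"]) auto
    qed
  next
    fix \<zeta> assume \<zeta>: "0 < Re \<zeta>"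
    have "c * e \<zeta> ^ d = e (of_nat d * \<zeta>)"
    proof -
      have "exp (- \<zeta>) ^ d = exp (- (of_nat d * \<zeta>))"
        by (simp add: exp_of_nat_mult[symmetric])
      then show ?thesis using \<kappa>d by (simp add: e_def power_mult_distrib mult.assoc[symmetric])
    qed
    then show "poly p (\<Psi> \<zeta>) = \<Psi> (of_nat (degree p) * \<zeta>)"
      using c(2)[OF eb[OF \<zeta>]] by (simp add: \<Psi>_def d_def)
  next
    fix \<zeta> and k :: int
    have "exp (- (\<zeta> + 2 * of_int k * of_real pi * \<i>)) = exp (- \<zeta>)"
      by (subst exp_eq) (intro exI[of _ "- k"], simp)
    then show "\<Psi> (\<zeta> + 2 * of_int k * of_real pi * \<i>) = \<Psi> \<zeta>"
      by (simp add: \<Psi>_def e_def)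
  next
    fix \<zeta> \<zeta>' assume z: "0 < Re \<zeta>" "0 < Re \<zeta>'" and eq: "\<Psi> \<zeta> = \<Psi> \<zeta>'"
    have "g (e \<zeta>) = g (e \<zeta>')"
      using eq gnz eb z by (simp add: \<Psi>_def)
    then have "e \<zeta> = e \<zeta>'" using gf eb z by metis
    then have "exp (- \<zeta>) = exp (- \<zeta>')" using \<kappa>0 by (simp add: e_def)
    then obtain k :: int where "- \<zeta> = - \<zeta>' + of_int (2 * k) * pi * \<i>" unfolding exp_eq by auto
    then have "\<zeta> = \<zeta>' + 2 * of_int (- k) * of_real pi * \<i>"
      by (simp add: algebra_simps)
    then show "\<exists>k::int. \<zeta> = \<zeta>' + 2 * of_int k * of_real pi * \<i>" by blast
  qed
qed

end

section \<open>Inverse branches of a Poincare function\<close>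

text \<open>
  \<open>f\<close> linearizes \<open>p\<close> at the repelling fixed point \<open>z0\<close>. That \<open>K\<close> has a second point makes the Riemann
  mapping theorem applicable to its complement.
\<close>

locale poincare = poly_dynamics +
  fixes z0 \<mu> :: complex and f :: "complex \<Rightarrow> complex"
  assumes K_conn: "connected (filled_Julia_set p)" and fix0: "poly p z0 = z0"
    and K_ne: "filled_Julia_set p \<noteq> {z0}"
    and lam: "norm \<mu> > 1"
    and holf: "f holomorphic_on UNIV" and f0: "f 0 = z0" and df0: "deriv f 0 \<noteq> 0"
    and feq: "\<And>z. f (\<mu> * z) = poly p (f z)"
begin

lemma multiplier_nonzero: "\<mu> \<noteq> 0" using lam by auto

lemma z0_K: "z0 \<in> K"
proof -
  have "(poly p ^^ n) z0 = z0" for n by (induction n) (auto simp: fix0)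
  then have "norm ((poly p ^^ n) z0) \<le> max R (norm z0)" for n by simp
  show ?thesis
  proof (rule ccontr)
    assume "z0 \<notin> K"
    then obtain m where "norm ((poly p ^^ m) z0) \<ge> R" using not_K_imp_escape by blast
    then have "norm z0 \<ge> R" using \<open>\<And>n. (poly p ^^ n) z0 = z0\<close> by simp
    from esc[OF this] show False using fix0 \<open>norm z0 \<ge> R\<close> R1 by simp
  qed
qed

lemma f_iter: "f (\<mu> ^ n * z) = (poly p ^^ n) (f z)"
  by (induction n) (auto simp: feq mult.assoc)

lemma f_iter_div: "(poly p ^^ n) (f (z / \<mu> ^ n)) = f z"
  using f_iter[of n "z / \<mu> ^ n"] multiplier_nonzero by simp

lemma scale_tendsto_0: "(\<lambda>n. z / \<mu> ^ n) \<longlonglongrightarrow> 0"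
proof -
  have "(\<lambda>n. z * (1 / \<mu>) ^ n) \<longlonglongrightarrow> z * 0"
    using lam by (intro tendsto_intros LIMSEQ_power_zero) (auto simp: norm_divide divide_less_eq)
  then show ?thesis by (simp add: power_divide divide_inverse power_inverse)
qed

text \<open>
  A branch of the inverse of \<open>f\<close> in logarithmic coordinates over a disc whose exponential avoids \<open>K\<close>. Put
  \<open>h n = \<Psi> ((\<xi> + 2 \<pi> i k) / d^n)\<close>, where \<open>\<xi>\<close> lifts \<open>exp\<close> through \<open>\<Psi>\<close> and the integer \<open>k\<close> is chosen such that
  \<open>h n y0 = f (exp x0 / \<mu>^n)\<close>; this is a branch of the inverse of \<open>p^n\<close>. The \<open>h n\<close> form a normal family, their
  values at \<open>y0\<close> tend to \<open>z0\<close>, and none of them takes the value \<open>z0 \<in> K\<close>. By Hurwitz's theorem a limit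
  function is constantly \<open>z0\<close>. So for some \<open>n\<close> the values of \<open>h n\<close> lie in a disc around \<open>z0\<close> on which \<open>f\<close> has a
  local inverse, and multiplying the latter by \<open>\<mu>^n\<close> gives the branch.
\<close>

lemma inverse_branch:
  assumes r: "0 < s" "s < r" and S: "\<And>y. y \<in> ball y0 r \<Longrightarrow> exp y \<notin> K"
    and x0: "f (exp x0) = exp y0"
  obtains G where "G holomorphic_on ball y0 s" "G y0 = x0" "\<And>y. y \<in> ball y0 s \<Longrightarrow> f (exp (G y)) = exp y"
proof -
  obtain \<Psi> where \<Psi>: "\<Psi> holomorphic_on {\<zeta>. 0 < Re \<zeta>}" "\<Psi> ` {\<zeta>. 0 < Re \<zeta>} = - K"
    and \<Psi>p: "\<And>\<zeta>. 0 < Re \<zeta> \<Longrightarrow> poly p (\<Psi> \<zeta>) = \<Psi> (of_nat (degree p) * \<zeta>)"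
    and per: "\<And>\<zeta> (k::int). \<Psi> (\<zeta> + 2 * of_int k * of_real pi * \<i>) = \<Psi> \<zeta>"
    and per': "\<And>\<zeta> \<zeta>'. 0 < Re \<zeta> \<Longrightarrow> 0 < Re \<zeta>' \<Longrightarrow> \<Psi> \<zeta> = \<Psi> \<zeta>' \<Longrightarrow> \<exists>k::int. \<zeta> = \<zeta>' + 2 * of_int k * of_real pi * \<i>"
    and lift: "\<And>q S. convex S \<Longrightarrow> q holomorphic_on S \<Longrightarrow> q ` S \<subseteq> - K \<Longrightarrow>
       \<exists>\<xi>. \<xi> holomorphic_on S \<and> (\<forall>x\<in>S. 0 < Re (\<xi> x) \<and> \<Psi> (\<xi> x) = q x)"
    by (rule Boettcher_uniformization[OF K_conn z0_K fix0 K_ne]) (rule that; assumption)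
  define S where "S = ball y0 r"
  have y0S: "y0 \<in> S" using r by (simp add: S_def)
  define d where "d = degree p"
  have d: "d \<ge> 2" using deg by (simp add: d_def)
  obtain \<xi> where \<xi>: "\<xi> holomorphic_on S" "\<And>y. y \<in> S \<Longrightarrow> 0 < Re (\<xi> y)" "\<And>y. y \<in> S \<Longrightarrow> \<Psi> (\<xi> y) = exp y"
  proof -
    have "exp ` S \<subseteq> - K" using S by (auto simp: S_def)
    then show ?thesis using that lift[of S exp] by (auto simp: S_def holomorphic_on_exp)
  qed
  have \<Psi>it: "(poly p ^^ n) (\<Psi> \<zeta>) = \<Psi> (of_nat (d ^ n) * \<zeta>)" if "0 < Re \<zeta>" for n \<zeta>
  proof (induction n)
    case (Suc n)
    have "0 < Re (of_nat (d ^ n) * \<zeta>)" using that d by simp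
    from \<Psi>p[OF this] show ?case using Suc by (simp add: d_def mult.assoc)
  qed simp
  define a where "a n = f (exp x0 / \<mu> ^ n)" for n
  have "\<exists>k::int. a n = \<Psi> ((\<xi> y0 + 2 * of_int k * of_real pi * \<i>) / of_nat (d ^ n))" for n
  proof -
    have it: "(poly p ^^ n) (a n) = exp y0" by (simp add: a_def f_iter_div x0)
    then have "a n \<notin> K" using S[of y0] y0S iter_K_iff[of n "a n"] by (simp add: S_def)
    then obtain \<eta> where \<eta>: "0 < Re \<eta>" "a n = \<Psi> \<eta>" using \<Psi>(2) by blast
    have "\<Psi> (of_nat (d ^ n) * \<eta>) = \<Psi> (\<xi> y0)"
      using it \<Psi>it[OF \<eta>(1), of n] \<eta>(2) \<xi>(3)[OF y0S] by simp
    moreover have "0 < Re (of_nat (d ^ n) * \<eta>)" using \<eta> d by simp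
    ultimately obtain k :: int where k: "of_nat (d ^ n) * \<eta> = \<xi> y0 + 2 * of_int k * of_real pi * \<i>"
      using per' \<xi>(2)[OF y0S] by blast
    have "\<eta> = (of_nat (d ^ n) * \<eta>) / of_nat (d ^ n)" using d by simp
    then have "a n = \<Psi> ((\<xi> y0 + 2 * of_int k * of_real pi * \<i>) / of_nat (d ^ n))"
      unfolding k using \<eta>(2) by simp
    then show ?thesis by blast
  qed
  then obtain k :: "nat \<Rightarrow> int" where k: "\<And>n. a n = \<Psi> ((\<xi> y0 + 2 * of_int (k n) * of_real pi * \<i>) / of_nat (d ^ n))"
    by metis
  define h where "h n y = \<Psi> ((\<xi> y + 2 * of_int (k n) * of_real pi * \<i>) / of_nat (d ^ n))" for n y
  have Re: "0 < Re ((\<xi> y + 2 * of_int (k n) * of_real pi * \<i>) / of_nat (d ^ n))" if "y \<in> S" for n y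
    using \<xi>(2)[OF that] d by (simp add: Re_divide_of_nat flip: of_nat_power)
  have hy0: "h n y0 = a n" for n by (simp add: h_def k)
  have hol: "h n holomorphic_on S" for n
    unfolding h_def using Re d
    by (intro holomorphic_on_compose_gen[OF _ \<Psi>(1), unfolded o_def] holomorphic_intros \<xi>(1)) auto
  have hit: "(poly p ^^ n) (h n y) = exp y" if "y \<in> S" for n y
    unfolding h_def using \<Psi>it[OF Re[OF that]] per \<xi>(3)[OF that] d by simp
  have hK: "h n y \<notin> K" if "y \<in> S" for n y
    using \<Psi>(2) Re[OF that] unfolding h_def by blast
  then have hz: "h n y \<noteq> z0" if "y \<in> S" for n y using that z0_K by metis
  obtain g \<rho> where g: "g holomorphic_on S" and \<rho>: "strict_mono (\<rho> :: nat \<Rightarrow> nat)"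
    and lim: "\<And>y. y \<in> S \<Longrightarrow> (\<lambda>n. h (\<rho> n) y) \<longlonglongrightarrow> g y"
    and ulim: "\<And>C. compact C \<Longrightarrow> C \<subseteq> S \<Longrightarrow> uniform_limit C (h \<circ> \<rho>) g sequentially"
  proof (rule Montel[of S "range h" h])
    show "open S" by (simp add: S_def)
    show "\<And>h'. h' \<in> range h \<Longrightarrow> h' holomorphic_on S" using hol by blast
    fix C assume C: "compact C" "C \<subseteq> S"
    have "bounded (exp ` C)"
      using C by (intro compact_imp_bounded compact_continuous_image continuous_intros)
    then obtain M where M: "\<And>y. y \<in> C \<Longrightarrow> norm (exp y) \<le> M" by (auto simp: bounded_iff)
    have "norm (h n y) \<le> max M R" if "y \<in> C" for n y
      using iter_le_imp_le[of n "h n y" "max M R"] hit[of y n] M[OF that] that C by auto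
    then show "\<exists>B. \<forall>h'\<in>range h. \<forall>y\<in>C. norm (h' y) \<le> B" by blast
  qed auto
  have "a \<longlonglongrightarrow> z0"
  proof -
    have "isCont f 0" using holf by (meson UNIV_I field_differentiable_imp_continuous_at holomorphic_on_imp_differentiable_at open_UNIV)
    from isCont_tendsto_compose[OF this scale_tendsto_0] show ?thesis by (simp add: a_def[abs_def] f0)
  qed
  then have "(\<lambda>n. h (\<rho> n) y0) \<longlonglongrightarrow> z0"
    unfolding hy0 using LIMSEQ_subseq_LIMSEQ[OF _ \<rho>] by (simp add: o_def)
  then have gy0: "g y0 = z0" using lim[OF y0S] LIMSEQ_unique by blast
  \<comment> \<open>Otherwise Hurwitz's theorem would forbid the limit \<open>g\<close> to take the value \<open>z0\<close>, which it takes at \<open>y0\<close>.\<close>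
  have gc: "g y = z0" if y: "y \<in> S" for y
  proof (rule ccontr)
    assume "g y \<noteq> z0"
    then have nc: "\<not> (\<lambda>y. g y - z0) constant_on S"
      unfolding constant_on_def using gy0 y y0S by (metis diff_add_cancel)
    have "g y0 - z0 \<noteq> 0"
    proof (rule Hurwitz_no_zeros[of S "\<lambda>n y. h (\<rho> n) y - z0" "\<lambda>y. g y - z0"])
      show "uniform_limit C (\<lambda>n y. h (\<rho> n) y - z0) (\<lambda>y. g y - z0) sequentially" if "compact C" "C \<subseteq> S" for C
        using ulim[OF that] by (intro uniform_limit_intros) (simp add: o_def)
    qed (use nc hz y0S g hol in \<open>auto simp: S_def intro!: holomorphic_intros\<close>)
    then show False using gy0 by simp
  qed
  obtain \<delta> where \<delta>: "0 < \<delta>" "open (f ` ball 0 \<delta>)" "inj_on f (ball 0 \<delta>)"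
    using has_complex_derivative_locally_invertible[OF holf _ open_UNIV df0] by blast
  obtain k' where k': "k' holomorphic_on f ` ball 0 \<delta>" "\<And>z. z \<in> ball 0 \<delta> \<Longrightarrow> k' (f z) = z"
    by (rule holomorphic_has_inverse[OF holomorphic_on_subset[OF holf subset_UNIV] open_ball \<delta>(3)]) blast
  have "z0 \<in> f ` ball 0 \<delta>" using f0 \<delta>(1) by force
  then obtain \<epsilon> where \<epsilon>: "0 < \<epsilon>" "ball z0 \<epsilon> \<subseteq> f ` ball 0 \<delta>"
    using \<delta>(2) open_contains_ball by blast
  have "cball y0 s \<subseteq> S" using r by (auto simp: S_def)
  then have "\<forall>\<^sub>F n in sequentially. \<forall>y\<in>cball y0 s. dist (h (\<rho> n) y) (g y) < \<epsilon>"
    using uniform_limitD[OF ulim[of "cball y0 s"] \<epsilon>(1)] by simp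
  moreover have "\<forall>\<^sub>F n in sequentially. exp x0 / \<mu> ^ (\<rho> n) \<in> ball 0 \<delta>"
    using tendstoD[OF LIMSEQ_subseq_LIMSEQ[OF scale_tendsto_0 \<rho>] \<delta>(1)] by (simp add: o_def dist_commute)
  ultimately have "\<forall>\<^sub>F n in sequentially. (\<forall>y\<in>cball y0 s. dist (h (\<rho> n) y) (g y) < \<epsilon>) \<and> exp x0 / \<mu> ^ (\<rho> n) \<in> ball 0 \<delta>"
    by (rule eventually_conj)
  from eventually_happens'[OF trivial_limit_sequentially this]
  obtain n where n: "\<And>y. y \<in> cball y0 s \<Longrightarrow> dist (h (\<rho> n) y) (g y) < \<epsilon>" "exp x0 / \<mu> ^ (\<rho> n) \<in> ball 0 \<delta>"
    by blast
  define m where "m = \<rho> n"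
  let ?B = "ball y0 s"
  have BS: "?B \<subseteq> S" using r by (auto simp: S_def)
  have hB: "h m y \<in> f ` ball 0 \<delta>" if "y \<in> ?B" for y
  proof -
    have "h m y \<in> ball z0 \<epsilon>"
      using n(1)[of y] gc[of y] that BS by (auto simp: m_def dist_commute)
    then show ?thesis using \<epsilon>(2) by blast
  qed
  have fk: "f (k' w) = w" "k' w \<in> ball 0 \<delta>" if "w \<in> f ` ball 0 \<delta>" for w
    using that k'(2) by auto
  define q where "q y = \<mu> ^ m * k' (h m y)" for y
  have holq: "q holomorphic_on ?B"
    unfolding q_def using hB BS
    by (intro holomorphic_intros holomorphic_on_compose_gen[OF _ k'(1), unfolded o_def] holomorphic_on_subset[OF hol]) auto
  have fq: "f (q y) = exp y" if "y \<in> ?B" for y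
    using f_iter[of m "k' (h m y)"] fk(1)[OF hB[OF that]] hit[of y m] that BS by (auto simp: q_def)
  have qnz: "q y \<noteq> 0" if y: "y \<in> ?B" for y
  proof
    assume "q y = 0"
    then have "exp y = z0" using fq[OF y] f0 by simp
    then show False using S[of y] y r z0_K by auto
  qed
  obtain L where L: "L holomorphic_on ?B" "\<And>y. y \<in> ?B \<Longrightarrow> q y = exp (L y)"
    using contractible_imp_holomorphic_log[OF holq convex_imp_contractible[OF convex_ball] qnz] by blast
  have "exp (L y0) = exp x0"
  proof -
    have "q y0 = \<mu> ^ m * k' (f (exp x0 / \<mu> ^ m))"
      by (simp add: q_def hy0 a_def)
    also have "\<dots> = exp x0" using k'(2)[of "exp x0 / \<mu> ^ m"] n(2) multiplier_nonzero by (simp add: m_def)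
    finally show ?thesis using L(2)[of y0] r by simp
  qed
  \<comment> \<open>The logarithm of \<open>q\<close> has the prescribed value at \<open>y0\<close> only up to a period.\<close>
  then obtain j :: int where j: "L y0 = x0 + complex_of_real (real_of_int (2 * j) * pi) * \<i>" unfolding exp_eq by blast
  show ?thesis
  proof (rule that[of "\<lambda>y. L y - complex_of_real (real_of_int (2 * j) * pi) * \<i>"])
    fix y assume y: "y \<in> ?B"
    have "exp (L y - complex_of_real (real_of_int (2 * j) * pi) * \<i>) = exp (L y)"
      by (subst exp_eq) (intro exI[of _ "- j"], simp)
    then show "f (exp (L y - complex_of_real (real_of_int (2 * j) * pi) * \<i>)) = exp y"
      using fq[OF y] L(2)[OF y] by simp
  qed (use j L(1) in \<open>auto intro!: holomorphic_intros\<close>)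
qed

end

section \<open>Expansion in the logarithmic coordinate\<close>

text \<open>
  Away from the zeros of its derivative, which are countably many, \<open>h\<close> is locally biholomorphic.
\<close>

lemma negligible_vimage_holomorphic:
  assumes h: "h holomorphic_on UNIV" and nz: "deriv h a \<noteq> 0" and T: "negligible T"
  shows "negligible (h -` T)"
proof -
  have "negligible {z \<in> {z. deriv h z \<noteq> 0}. h z \<in> T}"
  proof (rule negligible_differentiable_vimage[OF T, where f' = "\<lambda>z. (*) (deriv h z)"])
    show "(h has_derivative (*) (deriv h z)) (at z within {z. deriv h z \<noteq> 0})" for z
      using holomorphic_derivI[OF h open_UNIV, of z] has_derivative_at_withinI
      by (simp add: has_field_derivative_def)
  qed (auto simp: inj_on_def)
  moreover have "negligible {z. deriv h z = 0}"
  proof -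
    have "deriv h \<noteq> (\<lambda>_. 0)" using nz by auto
    then have "countable {z. deriv h z = 0}"
      using holomorphic_countable_equal_UNIV[of "deriv h" "\<lambda>_. 0"] h
      by (auto simp: holomorphic_deriv)
    from null_sets_completionI[OF countable_imp_null_set_lborel[OF this]]
    show ?thesis by (simp add: negligible_iff_null_sets)
  qed
  ultimately have "negligible ({z \<in> {z. deriv h z \<noteq> 0}. h z \<in> T} \<union> {z. deriv h z = 0})"
    by (rule negligible_Un)
  then show ?thesis by (rule negligible_subset) auto
qed

lemma negligible_exp_image: "negligible E \<Longrightarrow> negligible ((exp :: complex \<Rightarrow> complex) ` E)"
  by (rule negligible_differentiable_image_negligible)
    (auto intro!: holomorphic_on_imp_differentiable_on holomorphic_intros
      differentiable_on_subset[OF holomorphic_on_imp_differentiable_on[of exp UNIV]])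

lemma exp_inj_near:
  fixes x y :: complex
  assumes "exp x = exp y" "norm (x - y) < 2 * pi"
  shows "x = y"
proof -
  obtain n :: int where n: "x = y + complex_of_real (real_of_int (2 * n) * pi) * \<i>"
    using assms(1) unfolding exp_eq by blast
  then have "x - y = complex_of_real (real_of_int (2 * n) * pi) * \<i>" by simp
  then have "norm (x - y) = \<bar>real_of_int (2 * n) * pi\<bar>"
    by (simp only: norm_mult norm_ii norm_of_real mult_1_right)
  also have "\<dots> = 2 * pi * \<bar>real_of_int n\<bar>" by (simp add: abs_mult)
  finally have "\<bar>real_of_int n\<bar> < 1" using assms(2) by simp
  then have "n = 0" by linarith
  then show ?thesis using n by simp
qed

context poincare
begin

definition log_preim_K :: "complex set" where "log_preim_K = {x. f (exp x) \<in> K}"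

lemma cont_f: "continuous_on A f"
  using holf holomorphic_on_imp_continuous_on continuous_on_subset by blast

lemma closed_log_preim_K: "closed log_preim_K"
proof -
  have "closed ((\<lambda>x. f (exp x)) -` K)"
    by (intro closed_vimage closed_K continuous_on_compose2[OF cont_f] continuous_intros) auto
  then show ?thesis by (simp add: log_preim_K_def vimage_def)
qed

lemma log_preim_K_period: "x + of_int n * Ln \<mu> + of_int m * (2 * of_real pi * \<i>) \<in> log_preim_K \<longleftrightarrow> x \<in> log_preim_K"
proof -
  have e: "exp (y + of_int m * (2 * of_real pi * \<i>)) = exp y" for y
    by (subst exp_eq) (intro exI[of _ m], simp)
  have nat: "y + of_nat k * Ln \<mu> \<in> log_preim_K \<longleftrightarrow> y \<in> log_preim_K" for y k
  proof -
    have "exp (y + of_nat k * Ln \<mu>) = \<mu> ^ k * exp y"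
      using multiplier_nonzero by (simp add: exp_add exp_of_nat_mult)
    then show ?thesis by (simp add: log_preim_K_def f_iter iter_K_iff)
  qed
  have "x + of_int n * Ln \<mu> \<in> log_preim_K \<longleftrightarrow> x \<in> log_preim_K"
  proof (cases n rule: int_cases2)
    case (nonneg k)
    then show ?thesis using nat[of x k] by simp
  next
    case (nonpos k)
    then show ?thesis using nat[of "x + of_int n * Ln \<mu>" k] by simp
  qed
  then show ?thesis by (simp add: log_preim_K_def e)
qed

definition covering_radius :: real where "covering_radius = ln (norm \<mu>) + 2 * pi"

lemma covering_radius_pos: "0 < covering_radius" using lam ln_gt_zero[of "norm \<mu>"] pi_gt_zero unfolding covering_radius_def by linarith

text \<open>
  Reduce modulo \<open>2 \<pi> i\<close> and \<open>log \<mu>\<close>. These periods span a lattice because \<open>log \<mu>\<close> has positive real part.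
\<close>

lemma lattice_net:
  obtains v where "norm (v - w) \<le> covering_radius" "\<And>x. x + v \<in> log_preim_K \<longleftrightarrow> x \<in> log_preim_K"
proof -
  let ?l = "ln (norm \<mu>)"
  have l: "0 < ?l" "Re (Ln \<mu>) = ?l" using lam multiplier_nonzero by auto
  \<comment> \<open>First the real part is reduced by multiples of \<open>Ln \<mu>\<close>, then the imaginary part by multiples of \<open>2 \<pi>\<close>.\<close>
  define n where "n = \<lfloor>Re w / ?l\<rfloor>"
  define m where "m = \<lfloor>Im (w - of_int n * Ln \<mu>) / (2 * pi)\<rfloor>"
  define v where "v = of_int n * Ln \<mu> + of_int m * (2 * of_real pi * \<i>)"
  have "Re w / ?l - of_int n \<in> {0..1}" "Im (w - of_int n * Ln \<mu>) / (2 * pi) - of_int m \<in> {0..1}"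
    unfolding n_def m_def by (simp_all, linarith+)
  then have "Re w - of_int n * ?l \<in> {0..?l}" "Im (w - of_int n * Ln \<mu>) - of_int m * (2 * pi) \<in> {0..2*pi}"
    using l by (simp_all add: field_simps)
  then have "\<bar>Re (w - v)\<bar> \<le> ?l" "\<bar>Im (w - v)\<bar> \<le> 2 * pi"
    using l by (auto simp: v_def)
  then have "norm (w - v) \<le> covering_radius"
    using cmod_le[of "w - v"] by (simp add: covering_radius_def)
  moreover have "x + v \<in> log_preim_K \<longleftrightarrow> x \<in> log_preim_K" for x
    using log_preim_K_period[of x n m] by (simp add: v_def add.assoc)
  ultimately show ?thesis using that[of v] by (metis norm_minus_commute)
qed

text \<open>
  By Picard's little theorem \<open>f\<close> takes all values in \<open>K\<close> with at most one exception. Since \<open>exp\<close> and \<open>f\<close> map null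
  sets to null sets, the preimage of \<open>K\<close> cannot be null unless \<open>K\<close> is.
\<close>

lemma log_preim_K_not_negligible:
  assumes "\<not> negligible K"
  shows "\<exists>a. \<not> negligible (log_preim_K \<inter> ball a 1)"
proof (rule ccontr)
  assume "\<not> ?thesis"
  then have all: "negligible (log_preim_K \<inter> ball a 1)" for a by blast
  have "negligible log_preim_K"
  proof (rule locally_negligible_alt[THEN iffD2], rule ballI)
    fix x assume "x \<in> log_preim_K"
    then show "\<exists>U. openin (top_of_set log_preim_K) U \<and> x \<in> U \<and> negligible U"
      using all[of x] by (intro exI[of _ "log_preim_K \<inter> ball x 1"]) (auto intro: openin_open_Int)
  qed
  then have "negligible (exp ` log_preim_K)" by (rule negligible_exp_image)
  moreover have "f -` K \<subseteq> insert 0 (exp ` log_preim_K)"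
  proof
    fix z assume z: "z \<in> f -` K"
    show "z \<in> insert 0 (exp ` log_preim_K)"
    proof (cases "z = 0")
      case False
      then have "z = exp (Ln z)" by simp
      then have "Ln z \<in> log_preim_K" using z by (simp add: log_preim_K_def)
      then show ?thesis using \<open>z = exp (Ln z)\<close> by blast
    qed simp
  qed
  ultimately have "negligible (f -` K)"
    by (meson negligible_insert negligible_subset)
  then have fK: "negligible (f ` (f -` K))"
    by (rule negligible_differentiable_image_negligible[OF order_refl])
      (use holf holomorphic_on_imp_differentiable_on differentiable_on_subset in blast)
  have "\<exists>b. K \<subseteq> insert b (f ` (f -` K))"
  proof (rule ccontr)
    assume no: "\<nexists>b. K \<subseteq> insert b (f ` (f -` K))"
    then obtain b where b: "b \<in> K" "b \<notin> f ` (f -` K)" by blast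
    with no obtain c where c: "c \<in> K" "c \<notin> insert b (f ` (f -` K))" by blast
    have "range f \<inter> {b, c} = {}" using b c by auto
    then obtain e where "f = (\<lambda>x. e)"
      using little_Picard[OF holf, of b c] c by auto
    then show False using df0 by simp
  qed
  then show False using fK assms by (meson negligible_insert negligible_subset)
qed

text \<open>
  The image of \<open>G\<close> avoids \<open>log_preim_K\<close>, which meets every disc of radius larger than \<open>covering_radius\<close>;
  Bloch's theorem finds a disc of radius \<open>s * norm (deriv G y) / 12\<close> in the image.
\<close>

lemma branch_deriv_bound:
  assumes G: "G holomorphic_on ball y s" and s: "0 < s"
    and S: "\<And>y'. y' \<in> ball y s \<Longrightarrow> exp y' \<notin> K"
    and fG: "\<And>y'. y' \<in> ball y s \<Longrightarrow> f (exp (G y')) = exp y'"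
    and ne: "log_preim_K \<noteq> {}"
  shows "norm (deriv G y) \<le> 12 * covering_radius / s"
proof -
  define r' where "r' = s * norm (deriv G y) / 12"
  obtain b where b: "ball b r' \<subseteq> G ` ball y s"
    using Bloch[OF G s, of r'] by (auto simp: r'_def)
  obtain a where a: "a \<in> log_preim_K" using ne by blast
  obtain v where v: "norm (v - (b - a)) \<le> covering_radius" "a + v \<in> log_preim_K"
    using lattice_net[of "b - a"] a by metis
  have "\<not> covering_radius < r'"
  proof
    assume "covering_radius < r'"
    then have "a + v \<in> ball b r'" using v(1) by (simp add: dist_norm norm_minus_commute algebra_simps)
    then obtain y' where "y' \<in> ball y s" "a + v = G y'" using b by blast
    then show False using S fG v(2) by (auto simp: log_preim_K_def)
  qed
  then show ?thesis using s by (simp add: r'_def field_simps)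
qed

text \<open>
  A disc of radius \<open>disc_radius\<close> contains a translate of any given unit disc by a period of \<open>log_preim_K\<close>.
  Branches are constructed on discs of radius \<open>branch_radius\<close>: about each point of the smaller disc there remains
  room for a disc of radius \<open>24 * covering_radius + 1\<close>, which is enough for the derivative bound to give
  \<open>1/2\<close> and for univalence on the unit disc. To the right of \<open>escape_level\<close> these discs are mapped off \<open>K\<close>
  by \<open>exp\<close>.
\<close>

definition disc_radius :: real where "disc_radius = covering_radius + 1"
definition branch_radius :: real where "branch_radius = disc_radius + 24 * covering_radius + 1"
definition escape_level :: real where "escape_level = ln R + branch_radius + 1"

lemma exp_notin_K: assumes "ln R \<le> Re y" shows "exp y \<notin> K"
proof
  assume "exp y \<in> K"
  then have "exp (Re y) < R" using K_bound0[of "exp y"] by simp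
  then show False using assms R1 by (metis exp_le_cancel_iff exp_ln less_le_trans linorder_not_le zero_less_one)
qed

text \<open>
  One step back along an orbit. Univalence on unit discs is inherited from \<open>exp\<close>: two points with the same image
  under \<open>G\<close> have the same exponential.
\<close>

lemma branch_step:
  assumes ne: "log_preim_K \<noteq> {}"
  obtains C where "0 < C" "\<And>w x. escape_level \<le> Re w \<Longrightarrow> f (exp x) = exp w \<Longrightarrow>
    \<exists>G. G holomorphic_on ball w disc_radius \<and> G w = x \<and> (\<forall>y\<in>ball w disc_radius. f (exp (G y)) = exp y \<and> 0 < norm (deriv G y) \<and> norm (deriv G y) \<le> 1 / 2) \<and>
      bounded_distortion C G (ball w disc_radius)"
proof -
  obtain C where C: "0 < C"
    and dist: "\<And>G D S. open D \<Longrightarrow> G holomorphic_on D \<Longrightarrow> open S \<Longrightarrow> convex S \<Longrightarrow>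
      \<forall>w\<in>S. ball w 1 \<subseteq> D \<and> inj_on G (ball w 1) \<Longrightarrow> bounded_distortion C G S"
    by (rule univalent_on_unit_balls_bounded_distortion) (rule that; assumption)
  have radii: "0 < disc_radius" "0 < branch_radius" "disc_radius < branch_radius" using covering_radius_pos by (auto simp: disc_radius_def branch_radius_def)
  have main: "\<exists>G. G holomorphic_on ball w disc_radius \<and> G w = x \<and> (\<forall>y\<in>ball w disc_radius. f (exp (G y)) = exp y \<and> 0 < norm (deriv G y) \<and> norm (deriv G y) \<le> 1 / 2) \<and>
      bounded_distortion C G (ball w disc_radius)"
    if w: "escape_level \<le> Re w" and x: "f (exp x) = exp w" for w x
  proof -
    have nK: "exp y \<notin> K" if "y \<in> ball w (branch_radius + 1)" for y
    proof (rule exp_notin_K)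
      have "\<bar>Re (w - y)\<bar> < branch_radius + 1" using that abs_Re_le_cmod[of "w - y"] by (simp add: dist_norm)
      then show "ln R \<le> Re y" using w by (simp add: escape_level_def)
    qed
    obtain G where G: "G holomorphic_on ball w branch_radius" "G w = x" "\<And>y. y \<in> ball w branch_radius \<Longrightarrow> f (exp (G y)) = exp y"
      using inverse_branch[OF radii(2), of "branch_radius + 1", OF _ nK x] by auto
    have sub: "ball y (24 * covering_radius + 1) \<subseteq> ball w branch_radius" if "y \<in> ball w disc_radius" for y
    proof
      fix z assume "z \<in> ball y (24 * covering_radius + 1)"
      then show "z \<in> ball w branch_radius" using that dist_triangle[of w z y] by (simp add: branch_radius_def)
    qed
    have sub1: "ball y 1 \<subseteq> ball w branch_radius" if "y \<in> ball w disc_radius" for y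
      using sub[OF that] covering_radius_pos subset_ball[of 1 "24 * covering_radius + 1" y] by auto
    have inj: "inj_on G (ball y 1)" if y: "y \<in> ball w disc_radius" for y
    proof (rule inj_onI)
      fix u v assume u: "u \<in> ball y 1" "v \<in> ball y 1" "G u = G v"
      then have "exp u = exp v" using G(3) sub1[OF y] by (metis subsetD)
      moreover have "norm (u - v) < 2 * pi"
        using u dist_triangle[of u v y] pi_gt3 by (simp add: dist_norm norm_minus_commute)
      ultimately show "u = v" by (rule exp_inj_near)
    qed
    have bnd: "norm (deriv G y) \<le> 1 / 2" if y: "y \<in> ball w disc_radius" for y
    proof -
      have "norm (deriv G y) \<le> 12 * covering_radius / (24 * covering_radius + 1)"
      proof (rule branch_deriv_bound)
        show "G holomorphic_on ball y (24 * covering_radius + 1)"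
          using G(1) sub[OF y] holomorphic_on_subset by blast
        show "exp y' \<notin> K" if "y' \<in> ball y (24 * covering_radius + 1)" for y'
          using nK[of y'] sub[OF y] that by (auto simp: subset_iff intro: less_trans)
        show "f (exp (G y')) = exp y'" if "y' \<in> ball y (24 * covering_radius + 1)" for y'
          using G(3)[of y'] sub[OF y] that by blast
      qed (use covering_radius_pos ne in auto)
      also have "\<dots> \<le> 1 / 2" using covering_radius_pos by (simp add: field_simps)
      finally show ?thesis .
    qed
    have nz: "0 < norm (deriv G y)" if y: "y \<in> ball w disc_radius" for y
      using holomorphic_injective_imp_regular[of G "ball y 1" y] inj[OF y] sub1[OF y] G(1) holomorphic_on_subset
      by force
    have bw: "ball w disc_radius \<subseteq> ball w branch_radius" using radii by (intro subset_ball) simp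
    show ?thesis
    proof (intro exI[of _ G] conjI ballI)
      show "G holomorphic_on ball w disc_radius" using G(1) bw holomorphic_on_subset by blast
      show "bounded_distortion C G (ball w disc_radius)"
        by (rule dist[OF open_ball G(1) open_ball convex_ball]) (use sub1 inj in blast)
    qed (use G bw bnd nz in auto)
  qed
  show ?thesis by (rule that[OF C]) (rule main; assumption)
qed

text \<open>
  Compose the branches of the single steps. If a single step has distortion constant \<open>C\<close>, then \<open>2 * C\<close> serves
  for all compositions: the distortion exponent \<open>C * dist\<close> of the innermost branch is added to that of the
  others, which is at most \<open>2 * C * (dist / 2)\<close> because the innermost branch halves distances.
\<close>

lemma branch_chain:
  assumes ne: "log_preim_K \<noteq> {}"
  obtains C where "0 < C" "\<And>n x. (\<And>k. exp escape_level \<le> norm ((f ^^ k) (exp x))) \<Longrightarrow>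
    \<exists>w H. H holomorphic_on ball w disc_radius \<and> H w = x \<and>
      (\<forall>y\<in>ball w disc_radius. (f ^^ n) (exp (H y)) = exp y \<and> 0 < norm (deriv H y) \<and> norm (deriv H y) \<le> (1 / 2) ^ n) \<and>
      bounded_distortion C H (ball w disc_radius)"
proof -
  obtain C where C: "0 < C" and step: "\<And>w x. escape_level \<le> Re w \<Longrightarrow> f (exp x) = exp w \<Longrightarrow>
    \<exists>G. G holomorphic_on ball w disc_radius \<and> G w = x \<and> (\<forall>y\<in>ball w disc_radius. f (exp (G y)) = exp y \<and> 0 < norm (deriv G y) \<and> norm (deriv G y) \<le> 1 / 2) \<and>
      bounded_distortion C G (ball w disc_radius)"
    by (rule branch_step[OF ne]) (rule that; assumption)
  have radii: "0 < disc_radius" using covering_radius_pos by (auto simp: disc_radius_def)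
  have main: "\<exists>w H. H holomorphic_on ball w disc_radius \<and> H w = x \<and>
      (\<forall>y\<in>ball w disc_radius. (f ^^ n) (exp (H y)) = exp y \<and> 0 < norm (deriv H y) \<and> norm (deriv H y) \<le> (1 / 2) ^ n) \<and>
      bounded_distortion (2 * C) H (ball w disc_radius)"
    if x: "\<And>k. exp escape_level \<le> norm ((f ^^ k) (exp x))" for n x
  proof (induction n)
    case 0
    show ?case
      using C by (intro exI[of _ x] exI[of _ "\<lambda>y. y"]) (auto simp: bounded_distortion_def)
  next
    case (Suc n)
    then obtain w H where H: "H holomorphic_on ball w disc_radius" "H w = x"
      "\<And>y. y \<in> ball w disc_radius \<Longrightarrow> (f ^^ n) (exp (H y)) = exp y"
      "\<And>y. y \<in> ball w disc_radius \<Longrightarrow> 0 < norm (deriv H y)"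
      "\<And>y. y \<in> ball w disc_radius \<Longrightarrow> norm (deriv H y) \<le> (1 / 2) ^ n"
      "bounded_distortion (2 * C) H (ball w disc_radius)"
      by blast
    define w' where "w' = Ln ((f ^^ Suc n) (exp x))"
    have "0 < norm ((f ^^ Suc n) (exp x))" using x[of "Suc n"] less_le_trans[OF exp_gt_zero] by blast
    then have ew': "exp w' = (f ^^ Suc n) (exp x)" by (simp add: w'_def del: funpow.simps)
    have fw: "f (exp w) = exp w'" using H(3)[of w] H(2) radii ew' by simp
    have "exp escape_level \<le> exp (Re w')" using x[of "Suc n"] ew' by (metis norm_exp_eq_Re)
    then have Rew': "escape_level \<le> Re w'" by simp
    obtain G where G: "G holomorphic_on ball w' disc_radius" "G w' = w"
      "\<And>y. y \<in> ball w' disc_radius \<Longrightarrow> f (exp (G y)) = exp y"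
      "\<And>y. y \<in> ball w' disc_radius \<Longrightarrow> 0 < norm (deriv G y)"
      "\<And>y. y \<in> ball w' disc_radius \<Longrightarrow> norm (deriv G y) \<le> 1 / 2"
      "bounded_distortion C G (ball w' disc_radius)"
      using step[OF Rew' fw] by blast
    have contr: "dist (G y1) (G y2) \<le> 1 / 2 * dist y1 y2" if "y1 \<in> ball w' disc_radius" "y2 \<in> ball w' disc_radius" for y1 y2
      unfolding dist_norm
    proof (rule field_differentiable_bound[OF convex_ball])
      show "(G has_field_derivative deriv G z) (at z within ball w' disc_radius)" if "z \<in> ball w' disc_radius" for z
        using that G(1) by (simp add: holomorphic_derivI)
    qed (use that G in auto)
    have Gin: "G y \<in> ball w disc_radius" if y: "y \<in> ball w' disc_radius" for y
    proof -
      have "dist w (G y) \<le> 1 / 2 * dist w' y" using contr[of w' y] y G(2) radii by simp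
      also have "\<dots> \<le> 1 * dist w' y" by (intro mult_right_mono) auto
      also have "\<dots> < disc_radius" using y by simp
      finally show ?thesis by simp
    qed
    have dHG: "deriv (\<lambda>y. H (G y)) y = deriv H (G y) * deriv G y" if y: "y \<in> ball w' disc_radius" for y
    proof (rule DERIV_imp_deriv, rule DERIV_chain2[where f = H and g = G])
      show "(H has_field_derivative deriv H (G y)) (at (G y))"
        using H(1) Gin[OF y] by (simp add: holomorphic_derivI)
      show "(G has_field_derivative deriv G y) (at y)"
        using G(1) y by (simp add: holomorphic_derivI)
    qed
    show ?case
    proof (intro exI[of _ w'] exI[of _ "\<lambda>y. H (G y)"] conjI ballI)
      show "(\<lambda>y. H (G y)) holomorphic_on ball w' disc_radius"
        using Gin by (intro holomorphic_on_compose_gen[OF G(1) H(1), unfolded o_def]) blast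
      show "H (G w') = x" using G(2) H(2) by simp
    next
      fix y assume y: "y \<in> ball w' disc_radius"
      show "(f ^^ Suc n) (exp (H (G y))) = exp y"
        using H(3)[OF Gin[OF y]] G(3)[OF y] by simp
      show "0 < norm (deriv (\<lambda>y. H (G y)) y)"
        using H(4)[OF Gin[OF y]] G(4)[OF y] dHG[OF y] by simp
      show "norm (deriv (\<lambda>y. H (G y)) y) \<le> (1 / 2) ^ Suc n"
        using mult_mono[OF H(5)[OF Gin[OF y]] G(5)[OF y]] dHG[OF y] by (simp add: norm_mult)
    next
      show "bounded_distortion (2 * C) (\<lambda>y. H (G y)) (ball w' disc_radius)"
        unfolding bounded_distortion_def
      proof (intro ballI)
        fix y1 y2 assume y: "y1 \<in> ball w' disc_radius" "y2 \<in> ball w' disc_radius"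
        have "norm (deriv H (G y1)) \<le> exp (2 * C * dist (G y1) (G y2)) * norm (deriv H (G y2))"
          by (rule bounded_distortionD[OF H(6) Gin[OF y(1)] Gin[OF y(2)]])
        also have "\<dots> \<le> exp (C * dist y1 y2) * norm (deriv H (G y2))"
          using contr[OF y] C by (intro mult_right_mono) auto
        finally have "norm (deriv H (G y1)) * norm (deriv G y1) \<le>
            (exp (C * dist y1 y2) * norm (deriv H (G y2))) * (exp (C * dist y1 y2) * norm (deriv G y2))"
          using bounded_distortionD[OF G(6) y] by (intro mult_mono) auto
        also have "\<dots> = (exp (C * dist y1 y2) * exp (C * dist y1 y2)) * (norm (deriv H (G y2)) * norm (deriv G y2))"
          by (simp only: mult_ac)
        also have "exp (C * dist y1 y2) * exp (C * dist y1 y2) = exp (2 * C * dist y1 y2)"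
          by (simp add: mult_exp_exp)
        finally show "norm (deriv (\<lambda>y. H (G y)) y1) \<le> exp (2 * C * dist y1 y2) * norm (deriv (\<lambda>y. H (G y)) y2)"
          using dHG y by (simp add: norm_mult)
      qed
    qed
  qed
  show ?thesis
    by (rule that[of "2 * C"]) (use C in simp, rule main, assumption)
qed

end

section \<open>Density of the points with far orbits\<close>

context poincare
begin

text \<open>
  The logarithms of the points whose orbits stay in the region where the inverse branches contract.
\<close>

definition far_orbits :: "complex set" where
  "far_orbits = {x. \<forall>k. exp escape_level \<le> norm ((f ^^ k) (exp x))}"

lemma holf_iter: "(f ^^ k) holomorphic_on UNIV"
proof (induction k)
  case (Suc k)
  show ?case
    using holomorphic_on_compose_gen[OF Suc holf] by (simp add: comp_def)
qed (simp add: id_def)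

lemma closed_far_orbits: "closed far_orbits"
proof -
  have "continuous_on UNIV (\<lambda>x. (f ^^ k) (exp x))" for k
    by (rule continuous_on_compose2[OF holomorphic_on_imp_continuous_on[OF holf_iter]
          continuous_on_exp[OF continuous_on_id]]) simp
  then have "closed {x. exp escape_level \<le> norm ((f ^^ k) (exp x))}" for k
    by (intro closed_Collect_le continuous_intros)
  then show ?thesis unfolding far_orbits_def Collect_all_eq by auto
qed

lemma R_le_exp_escape_level: "R \<le> exp escape_level"
proof -
  have "exp (ln R) \<le> exp escape_level"
    using covering_radius_pos by (simp add: escape_level_def branch_radius_def disc_radius_def)
  then show ?thesis using R1 by simp
qed

text \<open>
  Around \<open>x\<close> the set of far orbits misses the image under \<open>H\<close>, the \<open>n\<close>-fold inverse branch, of a piece \<open>B\<close> of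
  \<open>log_preim_K\<close> of fixed area \<open>m\<close>. With \<open>\<eta>\<close> the modulus of the derivative of \<open>H\<close> at the centre and \<open>D\<close> the
  distortion bound, that image has area at least \<open>(\<eta> / D)\<^sup>2 * m\<close> and lies in the disc of radius
  \<open>s = D * \<eta> * disc_radius\<close> about \<open>x\<close>. The proportion \<open>\<kappa>\<close> of this disc does not depend on \<open>n\<close>, and \<open>s\<close> tends to 0.
\<close>

lemma negligible_far_orbits:
  assumes K: "\<not> negligible K"
  shows "negligible far_orbits"
proof -
  obtain a where a: "\<not> negligible (log_preim_K \<inter> ball a 1)"
    using log_preim_K_not_negligible[OF K] by blast
  then have ne: "log_preim_K \<noteq> {}" by auto
  obtain C where C: "0 < C" and chain: "\<And>n x. (\<And>k. exp escape_level \<le> norm ((f ^^ k) (exp x))) \<Longrightarrow>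
    \<exists>w H. H holomorphic_on ball w disc_radius \<and> H w = x \<and>
      (\<forall>y\<in>ball w disc_radius. (f ^^ n) (exp (H y)) = exp y \<and> 0 < norm (deriv H y) \<and> norm (deriv H y) \<le> (1 / 2) ^ n) \<and>
      bounded_distortion C H (ball w disc_radius)"
    by (rule branch_chain[OF ne]) blast
  have radii: "1 < disc_radius" using covering_radius_pos by (simp add: disc_radius_def)
  let ?\<mu> = "measure lebesgue :: complex set \<Rightarrow> real"
  let ?A = "log_preim_K \<inter> ball a 1"
  have A_lm: "?A \<in> lmeasurable"
    using fmeasurable_Int_fmeasurable[of "ball a 1" lebesgue log_preim_K] closed_log_preim_K by (simp add: Int_commute)
  define m where "m = ?\<mu> ?A"
  have m: "0 < m"
    using a A_lm by (simp add: m_def zero_less_measure_iff negligible_iff_measure)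
  define D where "D = exp (C * (2 * disc_radius))"
  have D: "0 < D" by (simp add: D_def)
  define \<beta> where "\<beta> = measure lebesgue (ball (0::complex) 1)"
  have \<beta>: "0 < \<beta>" unfolding \<beta>_def using content_ball_pos[of 1 "0::complex"] by simp
  define \<kappa> where "\<kappa> = m / (D\<^sup>2 * D\<^sup>2 * disc_radius\<^sup>2 * \<beta>)"
  have \<kappa>: "0 < \<kappa>" using m D radii \<beta> by (simp add: \<kappa>_def)
  show ?thesis
  proof (rule negligible_if_not_dense[of _ "min \<kappa> 1"])
    show "far_orbits \<in> sets lebesgue" using closed_far_orbits by (simp add: borel_closed)
  next
    fix x and \<delta> :: real assume x: "x \<in> far_orbits" and \<delta>: "0 < \<delta>"
    obtain n where n: "(1 / 2) ^ n < \<delta> / (D * disc_radius)"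
      using real_arch_pow_inv[of "\<delta> / (D * disc_radius)" "1 / 2"] \<delta> D radii by auto
    obtain w H where H: "H holomorphic_on ball w disc_radius" "H w = x"
      and fH: "\<And>y. y \<in> ball w disc_radius \<Longrightarrow> (f ^^ n) (exp (H y)) = exp y"
      and dH: "\<And>y. y \<in> ball w disc_radius \<Longrightarrow> 0 < norm (deriv H y)"
      and dH2: "\<And>y. y \<in> ball w disc_radius \<Longrightarrow> norm (deriv H y) \<le> (1 / 2) ^ n"
      and bd: "bounded_distortion C H (ball w disc_radius)"
      using chain[of x n] x unfolding far_orbits_def by blast
    have ww: "w \<in> ball w disc_radius" using radii by simp
    define \<eta> where "\<eta> = norm (deriv H w)"
    have \<eta>: "0 < \<eta>" "\<eta> \<le> (1 / 2) ^ n" using dH[OF ww] dH2[OF ww] by (auto simp: \<eta>_def)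
    have dist: "norm (deriv H y1) \<le> D * norm (deriv H y2)" if "y1 \<in> ball w disc_radius" "y2 \<in> ball w disc_radius" for y1 y2
    proof -
      have "dist y1 y2 \<le> 2 * disc_radius" using that dist_triangle[of y1 y2 w] by (simp add: dist_commute)
      then have "exp (C * dist y1 y2) \<le> D" using C by (simp add: D_def)
      then show ?thesis
        using bounded_distortionD[OF bd that] by (meson mult_right_mono norm_ge_zero order_trans)
    qed
    have up: "norm (deriv H y) \<le> D * \<eta>" and low: "\<eta> / D \<le> norm (deriv H y)" if "y \<in> ball w disc_radius" for y
      using dist[OF that ww] dist[OF ww that] D by (auto simp: \<eta>_def field_simps)
    define s where "s = D * \<eta> * disc_radius"
    have s: "0 < s" using D \<eta> radii by (simp add: s_def)
    have "s \<le> (1 / 2) ^ n * (D * disc_radius)" using \<eta> D radii by (simp add: s_def)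
    also have "\<dots> < \<delta>" using n D radii by (simp add: less_divide_eq)
    finally have s\<delta>: "s < \<delta>" .
    have HB: "H ` ball w disc_radius \<subseteq> ball x s"
    proof
      fix u assume "u \<in> H ` ball w disc_radius"
      then obtain y where y: "y \<in> ball w disc_radius" "u = H y" by blast
      have "norm (H y - H w) \<le> (D * \<eta>) * norm (y - w)"
      proof (rule field_differentiable_bound[OF convex_ball])
        show "(H has_field_derivative deriv H z) (at z within ball w disc_radius)" if "z \<in> ball w disc_radius" for z
          using that H(1) by (simp add: holomorphic_derivI)
      qed (use y ww up in auto)
      also have "\<dots> < s"
        unfolding s_def using y D \<eta> by (intro mult_strict_left_mono) (auto simp: dist_norm norm_minus_commute)
      finally show "u \<in> ball x s" using y H(2) by (simp add: dist_norm norm_minus_commute)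
    qed
    \<comment> \<open>Move the piece of \<open>log_preim_K\<close> in the unit disc about \<open>a\<close> by a period into the disc about \<open>w\<close>.\<close>
    obtain v where v: "norm (v - (w - a)) \<le> covering_radius" "\<And>x. x + v \<in> log_preim_K \<longleftrightarrow> x \<in> log_preim_K"
      using lattice_net[of "w - a"] by metis
    define V where "V = ball (a + v) 1"
    have Vsub: "V \<subseteq> ball w disc_radius"
    proof
      fix y assume "y \<in> V"
      moreover have "dist w (a + v) \<le> covering_radius"
        using v(1) by (simp add: dist_norm norm_minus_commute algebra_simps)
      ultimately show "y \<in> ball w disc_radius"
        using dist_triangle[of w y "a + v"] by (simp add: V_def disc_radius_def)
    qed
    define B where "B = (+) v ` ?A"
    have Blm: "B \<in> lmeasurable" unfolding B_def using A_lm by (rule measurable_translation)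
    have Bm: "?\<mu> B = m" unfolding B_def m_def by (rule measure_translation)
    have BV: "B \<subseteq> V" "B \<subseteq> log_preim_K"
      using v(2) by (auto simp: B_def V_def dist_norm add.commute)
    have injV: "inj_on H V"
    proof (rule inj_onI)
      fix y1 y2 assume y: "y1 \<in> V" "y2 \<in> V" "H y1 = H y2"
      then have "exp y1 = exp y2" using fH Vsub by (metis subsetD)
      moreover have "norm (y1 - y2) < 2 * pi"
        using y dist_triangle[of y1 y2 "a + v"] pi_gt3 by (simp add: V_def dist_norm norm_minus_commute)
      ultimately show "y1 = y2" by (rule exp_inj_near)
    qed
    have holV: "H holomorphic_on V" using H(1) Vsub holomorphic_on_subset by blast
    have oV: "open V" by (simp add: V_def)
    obtain k where k: "k holomorphic_on H ` V" "\<And>y. y \<in> V \<Longrightarrow> deriv H y * deriv k (H y) = 1"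
      "\<And>y. y \<in> V \<Longrightarrow> k (H y) = y"
      using holomorphic_has_inverse[OF holV oV injV] by blast
    have HBlm: "H ` B \<in> lmeasurable"
      by (rule measure_holomorphic_image_le(1)[OF oV holV _ _ BV(1) Blm, of "D * \<eta>"])
        (use D \<eta> up Vsub in auto)
    \<comment> \<open>The lower bound for the area of \<open>H ` B\<close> is the upper bound for the inverse \<open>k\<close> of \<open>H\<close>.\<close>
    have "?\<mu> (k ` H ` B) \<le> (D / \<eta>)\<^sup>2 * ?\<mu> (H ` B)"
    proof (rule measure_holomorphic_image_le(2))
      show "open (H ` V)" using open_mapping_thm3[OF holV oV injV] .
      show "norm (deriv k z) \<le> D / \<eta>" if z: "z \<in> H ` V" for z
      proof -
        obtain y where y: "y \<in> V" "z = H y" using z by blast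
        have "norm (deriv H y) * norm (deriv k z) = 1"
          using k(2)[OF y(1)] y(2) by (metis norm_mult norm_one)
        moreover have "\<eta> / D * norm (deriv k z) \<le> norm (deriv H y) * norm (deriv k z)"
          using low[of y] y(1) Vsub by (intro mult_right_mono) auto
        ultimately show ?thesis using \<eta> D by (simp add: field_simps)
      qed
    qed (use k D \<eta> BV HBlm in auto)
    moreover have "k ` H ` B = B"
      using k(3) BV(1) by (force simp: image_iff)
    ultimately have mle: "m \<le> (D / \<eta>)\<^sup>2 * ?\<mu> (H ` B)" using Bm by simp
    have disj: "H ` B \<inter> far_orbits = {}"
    proof -
      have "H y \<notin> far_orbits" if y: "y \<in> B" for y
      proof
        assume "H y \<in> far_orbits"
        then have "exp escape_level \<le> norm ((f ^^ Suc n) (exp (H y)))" unfolding far_orbits_def by blast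
        also have "(f ^^ Suc n) (exp (H y)) = f (exp y)" using fH[of y] y BV Vsub by auto
        finally have "R \<le> norm (f (exp y))" using R_le_exp_escape_level by linarith
        moreover have "f (exp y) \<in> K" using y BV by (auto simp: log_preim_K_def)
        ultimately show False using K_bound0 by fastforce
      qed
      then show ?thesis by blast
    qed
    have tlm: "far_orbits \<inter> ball x s \<in> lmeasurable"
      using fmeasurable_Int_fmeasurable[of "ball x s" lebesgue far_orbits] closed_far_orbits by (simp add: Int_commute)
    have "?\<mu> (far_orbits \<inter> ball x s) + ?\<mu> (H ` B) = ?\<mu> ((far_orbits \<inter> ball x s) \<union> H ` B)"
    proof -
      have "(far_orbits \<inter> ball x s) \<inter> H ` B = {}" using disj by blast
      then show ?thesis using measure_Un3[OF tlm HBlm] by simp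
    qed
    also have "\<dots> \<le> ?\<mu> (ball x s)"
      using tlm HBlm HB BV(1) Vsub by (intro measure_mono_fmeasurable) auto
    finally have total: "?\<mu> (far_orbits \<inter> ball x s) + ?\<mu> (H ` B) \<le> ?\<mu> (ball x s)" .
    have bs: "?\<mu> (ball x s) = s\<^sup>2 * \<beta>"
      using content_ball_conv_unit_ball[of s x] s by (simp add: \<beta>_def)
    have "\<kappa> * ?\<mu> (ball x s) = m * \<eta>\<^sup>2 / D\<^sup>2"
      unfolding bs unfolding \<kappa>_def s_def using D radii \<beta> by (simp add: power_mult_distrib field_simps)
    also have "\<dots> \<le> ?\<mu> (H ` B)"
      using mle D \<eta> by (simp add: power_divide field_simps)
    finally have "\<kappa> * ?\<mu> (ball x s) \<le> ?\<mu> (H ` B)" .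
    moreover have "min \<kappa> 1 * ?\<mu> (ball x s) \<le> \<kappa> * ?\<mu> (ball x s)"
      by (intro mult_right_mono) auto
    ultimately have "?\<mu> (far_orbits \<inter> ball x s) \<le> (1 - min \<kappa> 1) * ?\<mu> (ball x s)"
      using total by (simp add: left_diff_distrib)
    then show "\<exists>s>0. s < \<delta> \<and> ?\<mu> (far_orbits \<inter> ball x s) \<le> (1 - min \<kappa> 1) * ?\<mu> (ball x s)"
      using s s\<delta> by blast
  qed (use \<kappa> in auto)
qed

lemma negligible_vimage_iter: "negligible T \<Longrightarrow> negligible ((f ^^ n) -` T)"
proof (induction n arbitrary: T)
  case (Suc n)
  have "(f ^^ Suc n) -` T = (f ^^ n) -` (f -` T)" by auto
  then show ?case
    using Suc.IH[OF negligible_vimage_holomorphic[OF holf df0 Suc.prems]] by (simp only:)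
qed simp

theorem negligible_escaping_set:
  assumes K: "\<not> negligible K"
  shows "negligible (escaping_set f)"
proof -
  have "escaping_set f \<subseteq> (\<Union>n. (f ^^ n) -` (exp ` far_orbits))"
  proof
    fix z assume "z \<in> escaping_set f"
    then have "filterlim (\<lambda>n. norm ((f ^^ n) z)) at_top sequentially"
      by (simp add: escaping_set_def filterlim_at_infinity_conv_norm_at_top)
    then have "\<forall>\<^sub>F n in sequentially. exp escape_level \<le> norm ((f ^^ n) z)"
      by (simp add: filterlim_at_top)
    then obtain N where N: "\<And>n. n \<ge> N \<Longrightarrow> exp escape_level \<le> norm ((f ^^ n) z)"
      by (auto simp: eventually_sequentially)
    have "0 < norm ((f ^^ N) z)" using N[of N] less_le_trans[OF exp_gt_zero] by blast
    then have e: "exp (Ln ((f ^^ N) z)) = (f ^^ N) z" by simp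
    have "Ln ((f ^^ N) z) \<in> far_orbits"
      unfolding far_orbits_def mem_Collect_eq e
    proof
      fix k show "exp escape_level \<le> norm ((f ^^ k) ((f ^^ N) z))"
        using N[of "k + N"] by (simp add: funpow_add)
    qed
    then have "(f ^^ N) z \<in> exp ` far_orbits" using e by (metis imageI)
    then show "z \<in> (\<Union>n. (f ^^ n) -` (exp ` far_orbits))" by blast
  qed
  moreover have "negligible (\<Union>n. (f ^^ n) -` (exp ` far_orbits))"
    by (intro negligible_countable_Union) (auto intro: negligible_vimage_iter negligible_exp_image negligible_far_orbits[OF K])
  ultimately show ?thesis by (rule negligible_subset[rotated])
qed

end

theorem theorem1p6:
  fixes p :: "complex poly" and f :: "complex \<Rightarrow> complex"
  assumes "degree p \<ge> 2"
    and "connected (Julia_set p)"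
    and "Poincare_function p f"
    and "emeasure lebesgue (filled_Julia_set p) > 0"
  shows "escaping_set f \<in> null_sets lebesgue"
proof -
  obtain z0 where fix0: "poly p z0 = z0" and lam: "norm (poly (pderiv p) z0) > 1"
    and f: "f holomorphic_on UNIV" "f 0 = z0" "deriv f 0 = 1"
    and loc: "\<forall>\<^sub>F z in nhds 0. f (poly (pderiv p) z0 * z) = poly p (f z)"
    using assms(3) by (auto simp: Poincare_function_def Poincare_function_at_def repelling_fixed_point_def)
  let ?\<mu> = "poly (pderiv p) z0"
  obtain R where R: "R \<ge> 1" "\<And>z. norm z \<ge> R \<Longrightarrow> norm (poly p z) \<ge> 2 * norm z"
    using poly_escape_radius[OF assms(1)] by blast
  interpret poly_dynamics p R
    using assms(1) R by unfold_locales auto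
  have not_negl: "\<not> negligible (filled_Julia_set p)"
    using assms(4) by (auto simp: negligible_iff_null_sets)
  obtain U where U: "open U" "0 \<in> U" "\<And>z. z \<in> U \<Longrightarrow> f (?\<mu> * z) = poly p (f z)"
    using loc by (auto simp: eventually_nhds)
  have feq: "f (?\<mu> * z) = poly p (f z)" for z
  proof (rule analytic_continuation_open[of U UNIV "\<lambda>z. f (?\<mu> * z)" "\<lambda>z. poly p (f z)"])
    show "(\<lambda>z. f (?\<mu> * z)) holomorphic_on UNIV"
      by (rule holomorphic_on_compose_gen[OF _ f(1), unfolded o_def]) (auto intro!: holomorphic_intros)
    show "(\<lambda>z. poly p (f z)) holomorphic_on UNIV"
      by (intro holomorphic_intros f)
  qed (use U in auto)
  interpret poincare p R z0 ?\<mu> f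
  proof unfold_locales
    show "connected (filled_Julia_set p)" by (rule connected_K[OF assms(2)])
    show "filled_Julia_set p \<noteq> {z0}" using not_negl by auto
  qed (use fix0 lam f feq in auto)
  show ?thesis
    using negligible_escaping_set[OF not_negl] by (simp add: negligible_iff_null_sets)
qed

end
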